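(* Let $D\subset\mathbb{R}^3$ be open and let $\phi:D\to\mathbb{R}$ be admissible. Suppose $\{F_\alpha\}_{\alpha\in\mathbb{R}}$ is a family of subsets of $\mathbb{R}$ such that $F_\alpha\subset\phi_\alpha(D_\alpha)$ for each $\alpha$, and $\bigcup_{\alpha\in\mathbb{R}}(\{\alpha\}\times F_\alpha)$ is a (Lebesgue) measurable subset of $\mathbb{R}^2$. Then there exists a Borel set $E\subset\mathbb{R}^2$ such that $$\phi_\alpha(E\cap D_\alpha)\supset F_\alpha\quad\text{for all }\alpha\in\mathbb{R},$$ $$|\phi_\alpha(E\cap D_\alpha)\setminus F_\alpha|=0\quad\text{for almost every }\alpha\in\mathbb{R}.$$
   Context: View $\mathbb{R}^3$ as $\mathbb{R}\times\mathbb{R}^2$ with points written $(\alpha,x)$. For an open set $D\subset\mathbb{R}^3$ and $\phi:D\to\mathbb{R}$, put $D_\alpha=\{x\in\mathbb{R}^2:(\alpha,x)\in D\}$ (and $D'_\alpha$ likewise for $D'\subset D$) and $\phi_\alpha:D_\alpha\to\mathbb{R}$, $\phi_\alpha(x)=\phi(\alpha,x)$. $\nabla\phi_\alpha(x)=\nabla_x\phi(\alpha,x)$ is the gradient in $x$ only. $|\cdot|$ denotes Lebesgue measure of sets, and $|L|$ the length of a line segment $L$. $\operatorname{nbhd}_{\delta}(E)$ is the open $\delta$-neighborhood of $E$. Directions: $\theta\in\mathbb{R}/\pi\mathbb{Z}$ is identified with the unoriented direction $\pm(\cos\theta,\sin\theta)$; $|\theta_1-\theta_2|$ is the distance in $\mathbb{R}/\pi\mathbb{Z}$.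 $\phi$ is non-stationary if $\nabla\phi_\alpha(x)\ne0$ for all $(\alpha,x)\in D$; then $\theta_\alpha(x)\in\mathbb{R}/\pi\mathbb{Z}$ denotes the direction perpendicular to $\nabla\phi_\alpha(x)$. Angle monotonicity condition: for each fixed $x$ there is a choice of representatives $[a,a+\pi)$ for $\mathbb{R}/\pi\mathbb{Z}$ such that $\alpha\mapsto\theta_\alpha(x)$ is strictly increasing as a function $\{\alpha:(\alpha,x)\in D\}\to[a,a+\pi)$. Rectangle squishing condition: for every bounded $D'\subset D$ and every $\epsilon>0$ there is $\delta=\delta(D',\epsilon)>0$ such that: if $L\subset\mathbb{R}^2$ is a line segment of length $|L|\le\delta$ with direction $\theta_L$, and $\alpha\in\mathbb{R}$ is such that there exists $x\in D'_\alpha\cap\operatorname{nbhd}_{\delta|L|}(L)$ with $|\theta_\alpha(x)-\theta_L|\le\delta$, then $\phi_\alpha(\operatorname{nbhd}_{\delta|L|}(L)\cap D_\alpha)$ is contained in an interval of length at most $\epsilon|L|$. Admissible: $\phi:D\to\mathbb{R}$ is $C^1$, non-stationary, and satisfies the angle monotonicity condition and the rectangle squishing condition. *)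

theory Defs
  imports "HOL-Analysis.Analysis"
begin

text \<open>
  The plane \<open>\<real>\<^sup>2\<close> is \<open>real \<times> real\<close> and \<open>\<real>\<^sup>3 = \<real> \<times> \<real>\<^sup>2\<close> is \<open>real \<times> real \<times> real\<close>, both with
  the Euclidean norm. A function \<open>\<phi> : D \<rightarrow> \<real>\<close> is a total HOL function of which only the
  values on \<open>D\<close> matter (\<open>D\<close> is open), and \<open>\<phi>\<^sub>\<alpha>\<close> is \<open>curry \<phi> \<alpha>\<close>.
\<close>

definition slice :: "(real \<times> real \<times> real) set \<Rightarrow> real \<Rightarrow> (real \<times> real) set" where
  "slice D \<alpha> = {x. (\<alpha>, x) \<in> D}"

definition nbhd :: "real \<Rightarrow> 'a::metric_space set \<Rightarrow> 'a set" where
  "nbhd \<delta> E = (\<Union>y\<in>E. ball y \<delta>)"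

definition grad_at :: "(real \<times> real \<times> real \<Rightarrow> real) \<Rightarrow> real \<Rightarrow> real \<times> real \<Rightarrow> real \<times> real" where
  "grad_at \<phi> \<alpha> x = (THE g. GDERIV (curry \<phi> \<alpha>) x :> g)"

definition C1_on :: "'a::real_normed_vector set \<Rightarrow> ('a \<Rightarrow> 'b::real_normed_vector) \<Rightarrow> bool" where
  "C1_on D f \<longleftrightarrow>
    (\<exists>f'. (\<forall>p\<in>D. (f has_derivative blinfun_apply (f' p)) (at p)) \<and> continuous_on D f')"

text \<open>
  An element of \<open>\<real>/\<pi>\<int>\<close> is a coset of \<open>\<pi>\<int>\<close>, that is, an element of \<open>UNIV // mod_pi\<close>. The metric on
  \<open>\<real>/\<pi>\<int>\<close> is the quotient metric, which is \<^const>\<open>setdist\<close> on cosets.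
\<close>

definition mod_pi :: "(real \<times> real) set" where
  "mod_pi = {(s, t). \<exists>k::int. s - t = of_int k * pi}"

text \<open>
  The coset of all \<open>t\<close> such that \<open>v\<close> is parallel, respectively perpendicular, to
  \<open>(cos t, sin t)\<close>. Both are meaningful only for \<open>v \<noteq> 0\<close>.
\<close>

definition direction :: "real \<times> real \<Rightarrow> real set" where
  "direction v = {t. \<exists>c. v = c *\<^sub>R (cos t, sin t)}"

definition perp_direction :: "real \<times> real \<Rightarrow> real set" where
  "perp_direction v = {t. v \<bullet> (cos t, sin t) = 0}"

definition angle_rep :: "real \<Rightarrow> real set \<Rightarrow> real" where
  "angle_rep a c = (THE t. t \<in> c \<and> t \<in> {a..<a + pi})"

definition theta :: "(real \<times> real \<times> real \<Rightarrow> real) \<Rightarrow> real \<Rightarrow> real \<times> real \<Rightarrow> real set" where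
  "theta \<phi> \<alpha> x = perp_direction (grad_at \<phi> \<alpha> x)"

definition non_stationary ::
    "(real \<times> real \<times> real) set \<Rightarrow> (real \<times> real \<times> real \<Rightarrow> real) \<Rightarrow> bool" where
  "non_stationary D \<phi> \<longleftrightarrow> (\<forall>(\<alpha>, x)\<in>D. grad_at \<phi> \<alpha> x \<noteq> 0)"

definition angle_monotonicity ::
    "(real \<times> real \<times> real) set \<Rightarrow> (real \<times> real \<times> real \<Rightarrow> real) \<Rightarrow> bool" where
  "angle_monotonicity D \<phi> \<longleftrightarrow>
    (\<forall>x. \<exists>a. strict_mono_on {\<alpha>. (\<alpha>, x) \<in> D} (\<lambda>\<alpha>. angle_rep a (theta \<phi> \<alpha> x)))"

text \<open>
  The segment is \<open>L = closed_segment p q\<close> with \<open>p \<noteq> q\<close>, so that it has a direction and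
  \<open>\<bar>L\<bar> = dist p q > 0\<close>.
\<close>

definition rectangle_squishing ::
    "(real \<times> real \<times> real) set \<Rightarrow> (real \<times> real \<times> real \<Rightarrow> real) \<Rightarrow> bool" where
  "rectangle_squishing D \<phi> \<longleftrightarrow>
    (\<forall>D' \<epsilon>. D' \<subseteq> D \<and> bounded D' \<and> \<epsilon> > 0 \<longrightarrow>
      (\<exists>\<delta>>0. \<forall>p q \<alpha>.
        p \<noteq> q \<and> dist p q \<le> \<delta> \<and>
        (\<exists>x \<in> slice D' \<alpha> \<inter> nbhd (\<delta> * dist p q) (closed_segment p q).
           setdist (theta \<phi> \<alpha> x) (direction (q - p)) \<le> \<delta>) \<longrightarrow>
        (\<exists>a b. b - a \<le> \<epsilon> * dist p q \<and>
           curry \<phi> \<alpha> ` (nbhd (\<delta> * dist p q) (closed_segment p q) \<inter> slice D \<alpha>) \<subseteq> {a..b})))"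

definition admissible ::
    "(real \<times> real \<times> real) set \<Rightarrow> (real \<times> real \<times> real \<Rightarrow> real) \<Rightarrow> bool" where
  "admissible D \<phi> \<longleftrightarrow>
    C1_on D \<phi> \<and> non_stationary D \<phi> \<and> angle_monotonicity D \<phi> \<and> rectangle_squishing D \<phi>"

lemma grad_at_eqI:
  assumes "GDERIV (curry \<phi> \<alpha>) x :> g"
  shows "grad_at \<phi> \<alpha> x = g"
  unfolding grad_at_def
proof (rule the_equality)
  fix g' assume "GDERIV (curry \<phi> \<alpha>) x :> g'"
  then have "(\<lambda>h. h \<bullet> g') = (\<lambda>h. h \<bullet> g)"
    using assms unfolding gderiv_def by (rule has_derivative_unique)
  then have "h \<bullet> g' = h \<bullet> g" for h
    by (rule fun_cong)
  then show "g' = g"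
    by (simp only: vector_eq_ldot[symmetric, of g' g] simp_thms)
qed (fact assms)

lemma C1_on_GDERIV_grad_at:
  assumes "C1_on D \<phi>" "(\<alpha>, x) \<in> D"
  shows "GDERIV (curry \<phi> \<alpha>) x :> grad_at \<phi> \<alpha> x"
proof -
  obtain f' where "(\<phi> has_derivative blinfun_apply f') (at (\<alpha>, x))"
    using assms unfolding C1_on_def by blast
  moreover have "((\<lambda>y. (\<alpha>, y)) has_derivative (\<lambda>h. (0, h))) (at x)"
    by (auto intro!: derivative_eq_intros)
  ultimately have d: "(curry \<phi> \<alpha> has_derivative (\<lambda>h. blinfun_apply f' (0, h))) (at x)"
    using has_derivative_compose[of "\<lambda>y. (\<alpha>, y)" "\<lambda>h. (0, h)" x UNIV \<phi>]
    by (simp add: curry_def)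
  define g where "g = (blinfun_apply f' (0, 1, 0), blinfun_apply f' (0, 0, 1))"
  have "blinfun_apply f' (0, h) = h \<bullet> g" for h
  proof (cases h)
    case (Pair u v)
    have "(0::real, h) = u *\<^sub>R (0, 1, 0) + v *\<^sub>R (0, 0, 1)"
      by (simp add: Pair)
    then have "blinfun_apply f' (0, h) =
        u * blinfun_apply f' (0, 1, 0) + v * blinfun_apply f' (0, 0, 1)"
      by (simp only: blinfun.add_right blinfun.scaleR_right real_scaleR_def)
    then show ?thesis by (simp add: g_def Pair)
  qed
  with d have "GDERIV (curry \<phi> \<alpha>) x :> g"
    by (simp add: gderiv_def)
  then show ?thesis by (simp only: grad_at_eqI)
qed

lemma sin_diff_eq_0_iff: "sin (s - t) = 0 \<longleftrightarrow> (s, t) \<in> mod_pi"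
  by (auto simp: mod_pi_def sin_zero_iff_int2)

lemma equiv_mod_pi: "equiv UNIV mod_pi"
proof (rule equivI)
  show "sym mod_pi"
  proof (rule symI)
    fix s t assume "(s, t) \<in> mod_pi"
    then have "- sin (s - t) = 0" by (simp add: sin_diff_eq_0_iff)
    then have "sin (t - s) = 0" unfolding sin_minus[symmetric] by simp
    then show "(t, s) \<in> mod_pi" by (simp add: sin_diff_eq_0_iff)
  qed
  show "trans mod_pi"
  proof (rule transI)
    fix r s t assume "(r, s) \<in> mod_pi" "(s, t) \<in> mod_pi"
    then obtain k l :: int where "r - s = k * pi" "s - t = l * pi"
      by (auto simp: mod_pi_def)
    then have "r - t = of_int (k + l) * pi" by (simp add: algebra_simps)
    then show "(r, t) \<in> mod_pi" unfolding mod_pi_def by blast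
  qed
qed (auto simp: refl_on_def sin_diff_eq_0_iff[symmetric])

lemma direction_in_quotient:
  assumes "v \<noteq> 0"
  shows "direction v \<in> UNIV // mod_pi"
proof -
  define z where "z = Complex (fst v) (snd v)"
  have z: "z \<noteq> 0" using assms by (auto simp: z_def complex_eq_iff prod_eq_iff)
  have "z = cmod z *\<^sub>R cis (Arg z)"
    by (metis rcis_cmod_Arg rcis_def scaleR_conv_of_real)
  then have v: "v = cmod z *\<^sub>R (cos (Arg z), sin (Arg z))"
    by (auto simp: z_def complex_eq_iff prod_eq_iff)
  obtain r s where r: "r \<noteq> 0" and v: "v = r *\<^sub>R (cos s, sin s)"
    using v z by (metis norm_eq_zero)
  have "t \<in> direction v \<longleftrightarrow> sin (s - t) = 0" for t
  proof
    assume "t \<in> direction v"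
    then obtain c where c: "r * cos s = c * cos t" "r * sin s = c * sin t"
      by (auto simp: direction_def v)
    have "r * sin (s - t) = (r * sin s) * cos t - (r * cos s) * sin t"
      by (simp add: sin_diff algebra_simps)
    also have "\<dots> = (c * sin t) * cos t - (c * cos t) * sin t"
      by (simp only: c)
    finally have "r * sin (s - t) = 0" by simp
    then show "sin (s - t) = 0" using r by simp
  next
    assume *: "sin (s - t) = 0"
    have "cos s = cos ((s - t) + t)" "sin s = sin ((s - t) + t)" by simp_all
    then have "cos s = cos (s - t) * cos t" "sin s = cos (s - t) * sin t"
      using * by (simp_all only: cos_add sin_add)
    then have "v = (r * cos (s - t)) *\<^sub>R (cos t, sin t)" by (simp add: v)
    then show "t \<in> direction v" unfolding direction_def by blast
  qed
  then have "direction v = mod_pi `` {s}"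
    by (auto simp: sin_diff_eq_0_iff)
  then show ?thesis by (simp add: quotientI)
qed

lemma perp_direction_eq_direction:
  "perp_direction v = direction (- snd v, fst v)"
proof (intro set_eqI iffI)
  fix t assume "t \<in> perp_direction v"
  then have *: "fst v * cos t + snd v * sin t = 0"
    by (auto simp: perp_direction_def inner_prod_def)
  define c where "c = fst v * sin t - snd v * cos t"
  have "c * cos t = - snd v * (cos t ^ 2 + sin t ^ 2) + sin t * (fst v * cos t + snd v * sin t)"
    "c * sin t = fst v * (cos t ^ 2 + sin t ^ 2) - cos t * (fst v * cos t + snd v * sin t)"
    unfolding c_def power2_eq_square by algebra+
  then have "(- snd v, fst v) = c *\<^sub>R (cos t, sin t)" using * by simp
  then show "t \<in> direction (- snd v, fst v)" unfolding direction_def by blast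
next
  fix t assume "t \<in> direction (- snd v, fst v)"
  then obtain c where "- snd v = c * cos t" and f: "fst v = c * sin t"
    by (auto simp: direction_def)
  then have "snd v = - (c * cos t)" by linarith
  with f show "t \<in> perp_direction v"
    by (simp add: perp_direction_def inner_prod_def)
qed

lemma angle_rep_unique:
  assumes "c \<in> UNIV // mod_pi"
  shows "\<exists>!t. t \<in> c \<and> t \<in> {a..<a + pi}"
proof -
  obtain s where c: "c = mod_pi `` {s}" using assms by (auto elim: quotientE)
  define k where "k = \<lfloor>(s - a) / pi\<rfloor>"
  have k: "of_int k * pi \<le> s - a" "s - a < (of_int k + 1) * pi"
    using floor_correct[of "(s - a) / pi"]
    by (simp_all only: k_def of_int_add of_int_1 pos_le_divide_eq pos_divide_less_eq pi_gt_zero)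
  show ?thesis
  proof (rule ex1I[of _ "s - of_int k * pi"])
    show "s - of_int k * pi \<in> c \<and> s - of_int k * pi \<in> {a..<a + pi}"
      using k by (auto simp: c mod_pi_def algebra_simps)
  next
    fix t assume t: "t \<in> c \<and> t \<in> {a..<a + pi}"
    then obtain l :: int where l: "s - t = of_int l * pi" by (auto simp: c mod_pi_def)
    with t have "of_int l * pi \<le> s - a" "s - a < (of_int l + 1) * pi"
      by (auto simp: algebra_simps)
    then have "l = k" unfolding k_def
      by (intro floor_unique[symmetric])
        (simp_all only: pos_le_divide_eq pos_divide_less_eq pi_gt_zero)
    then show "t = s - of_int k * pi" using l by simp
  qed
qed

end

theory Submission
  imports Defs
begin

text \<open>
  A point \<open>x\<close> of the plane is identified with the curve \<open>\<alpha> \<mapsto> (\<alpha>, \<phi>\<^sub>\<alpha>(x))\<close>, so that the union of the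
  curves of \<open>E\<close> (the shadow of \<open>E\<close>) has to cover a given measurable set up to a null set. Locally this
  is a Venetian blind construction: a short segment through \<open>x\<^sub>0\<close> is replaced by many tiny parallel
  segments, whose direction is turned in small steps from \<open>a\<close> towards \<open>b\<close>. By angle monotonicity
  \<open>a\<close> and \<open>b\<close> can be chosen such that the rotating direction never meets the level curves of \<open>\<phi>\<^sub>\<alpha>\<close>
  for \<open>\<alpha>\<close> close to \<open>\<alpha>\<^sub>0\<close>, where the image under \<open>\<phi>\<^sub>\<alpha>\<close> is therefore preserved, but becomes
  tangent to them at some moment for all other \<open>\<alpha>\<close>, after which the image under \<open>\<phi>\<^sub>\<alpha>\<close> is tiny. Such
  blinds cover an open set \<open>T\<close> with small excess outside \<open>T\<close>. Iterating this inside the blinds already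
  constructed, for outer approximations of the given set, yields \<open>E\<close> as a countable intersection of
  open sets. The excess is controlled on compact subsets exhausting \<open>D\<close>, where the needed
  uniformity comes from the uniform continuity of the gradient.
\<close>

section \<open>Angle monotonicity\<close>

lemma perp_direction_angle_rep:
  assumes "v \<noteq> 0"
  shows "v \<bullet> (cos (angle_rep A (perp_direction v)), sin (angle_rep A (perp_direction v))) = 0"
    and "A \<le> angle_rep A (perp_direction v)" and "angle_rep A (perp_direction v) < A + pi"
proof -
  have "(- snd v, fst v) \<noteq> 0"
    using assms by (auto simp: prod_eq_iff)
  then have "perp_direction v \<in> UNIV // mod_pi"
    unfolding perp_direction_eq_direction by (rule direction_in_quotient)
  then have "angle_rep A (perp_direction v) \<in> perp_direction v \<and>
      angle_rep A (perp_direction v) \<in> {A..<A + pi}"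
    unfolding angle_rep_def by (intro theI'[OF angle_rep_unique])
  then show "v \<bullet> (cos (angle_rep A (perp_direction v)), sin (angle_rep A (perp_direction v))) = 0"
    and "A \<le> angle_rep A (perp_direction v)" and "angle_rep A (perp_direction v) < A + pi"
    by (auto simp: perp_direction_def)
qed

text \<open>Such a \<open>v\<close> is a multiple of the unit vector at angle
  \<open>s + pi / 2\<close>, so its components vary like the sine of the angle measured from
  \<open>s\<close>. In this form the sign of a directional derivative can be read off from
  angles.\<close>

lemma inner_unit_circle:
  fixes v :: "real \<times> real"
  assumes "v \<bullet> (cos s, sin s) = 0"
  shows "v \<bullet> (cos t, sin t) = (v \<bullet> (- sin s, cos s)) * sin (t - s)"
proof -
  have "v \<bullet> (cos t, sin t) = v \<bullet> (cos (s + (t - s)), sin (s + (t - s)))"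
    by simp
  also have "\<dots> = (v \<bullet> (cos s, sin s)) * cos (t - s) + (v \<bullet> (- sin s, cos s)) * sin (t - s)"
    unfolding cos_add sin_add by (cases v) (simp add: algebra_simps)
  finally show ?thesis using assms by simp
qed

text \<open>Up to sign, \<open>a\<close> is tangent to the level curve through \<open>x\<close> at
  the parameter \<open>\<alpha>0 + h\<close>, and \<open>b\<close> to the one at
  \<open>\<alpha>0 - h\<close>. All angles lie in one interval of length \<open>pi\<close> and
  increase with the parameter, so the sine of a difference of two angles has the sign of the
  difference of the parameters. The two sines in question have opposite signs at \<alpha>0 and equal
  signs farther than \<open>h\<close> from it; the minus sign in \<open>b\<close> turns this into
  the claim.\<close>

lemma transversal_pair:
  assumes ns: "non_stationary D \<phi>" and am: "angle_monotonicity D \<phi>" and "h > 0"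
    and D: "(\<alpha>0, x) \<in> D" "(\<alpha>0 - h, x) \<in> D" "(\<alpha>0 + h, x) \<in> D"
  obtains a b where "grad_at \<phi> \<alpha>0 x \<bullet> a > 0" "grad_at \<phi> \<alpha>0 x \<bullet> b > 0"
    "\<And>\<alpha>. (\<alpha>, x) \<in> D \<Longrightarrow> \<bar>\<alpha> - \<alpha>0\<bar> > h \<Longrightarrow> (grad_at \<phi> \<alpha> x \<bullet> a) * (grad_at \<phi> \<alpha> x \<bullet> b) < 0"
proof -
  obtain A where mono: "strict_mono_on {\<alpha>. (\<alpha>, x) \<in> D} (\<lambda>\<alpha>. angle_rep A (theta \<phi> \<alpha> x))"
    using am unfolding angle_monotonicity_def by blast
  define T where "T \<alpha> = angle_rep A (theta \<phi> \<alpha> x)" for \<alpha>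
  define r where "r \<alpha> = grad_at \<phi> \<alpha> x \<bullet> (- sin (T \<alpha>), cos (T \<alpha>))" for \<alpha>
  have nz: "grad_at \<phi> \<alpha> x \<noteq> 0" if "(\<alpha>, x) \<in> D" for \<alpha>
    using ns that unfolding non_stationary_def by auto
  have less: "T \<alpha> < T \<beta>" if "(\<alpha>, x) \<in> D" "(\<beta>, x) \<in> D" "\<alpha> < \<beta>" for \<alpha> \<beta>
    using mono that unfolding strict_mono_on_def T_def by auto
  have bnd: "A \<le> T \<alpha>" "T \<alpha> < A + pi" if "(\<alpha>, x) \<in> D" for \<alpha>
    using perp_direction_angle_rep[OF nz[OF that]] unfolding T_def theta_def by auto
  have inn: "grad_at \<phi> \<alpha> x \<bullet> (cos t, sin t) = r \<alpha> * sin (t - T \<alpha>)" if "(\<alpha>, x) \<in> D" for \<alpha> t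
    unfolding r_def using perp_direction_angle_rep(1)[OF nz[OF that]]
    by (intro inner_unit_circle) (simp add: T_def theta_def)
  have r: "r \<alpha> \<noteq> 0" if "(\<alpha>, x) \<in> D" for \<alpha>
  proof
    assume "r \<alpha> = 0"
    then have "grad_at \<phi> \<alpha> x \<bullet> (cos 0, sin 0) = 0" "grad_at \<phi> \<alpha> x \<bullet> (cos (pi/2), sin (pi/2)) = 0"
      using inn[OF that] by (metis mult_zero_left)+
    then have "grad_at \<phi> \<alpha> x = 0" by (cases "grad_at \<phi> \<alpha> x") (simp add: inner_prod_def zero_prod_def)
    then show False using nz[OF that] by simp
  qed
  have pos: "sin (T \<beta> - T \<alpha>) > 0" if "(\<alpha>, x) \<in> D" "(\<beta>, x) \<in> D" "\<alpha> < \<beta>" for \<alpha> \<beta>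
    using less[OF that] bnd[OF that(1)] bnd[OF that(2)] by (intro sin_gt_zero) auto
  have neg: "sin (T \<beta> - T \<alpha>) < 0" if "(\<alpha>, x) \<in> D" "(\<beta>, x) \<in> D" "\<beta> < \<alpha>" for \<alpha> \<beta>
    using pos[OF that(2,1,3)] sin_minus[of "T \<alpha> - T \<beta>"] by simp
  \<comment> \<open>The sign of \<open>r\<close> is only normalized at \<alpha>0. For every other
    parameter \<open>r\<close> enters the product through its square.\<close>
  define \<sigma> where "\<sigma> = sgn (r \<alpha>0)"
  have \<sigma>: "r \<alpha>0 * \<sigma> > 0" "\<sigma>\<^sup>2 = 1"
    using r[OF D(1)] by (auto simp: \<sigma>_def sgn_if)
  define a where "a = \<sigma> *\<^sub>R (cos (T (\<alpha>0 + h)), sin (T (\<alpha>0 + h)))"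
  define b where "b = (- \<sigma>) *\<^sub>R (cos (T (\<alpha>0 - h)), sin (T (\<alpha>0 - h)))"
  have ga: "grad_at \<phi> \<alpha> x \<bullet> a = (r \<alpha> * \<sigma>) * sin (T (\<alpha>0 + h) - T \<alpha>)" if "(\<alpha>, x) \<in> D" for \<alpha>
    unfolding a_def inner_scaleR_right inn[OF that] by simp
  have gb: "grad_at \<phi> \<alpha> x \<bullet> b = (r \<alpha> * \<sigma>) * (- sin (T (\<alpha>0 - h) - T \<alpha>))" if "(\<alpha>, x) \<in> D" for \<alpha>
    unfolding b_def inner_scaleR_right inn[OF that] by simp
  show thesis
  proof
    show "grad_at \<phi> \<alpha>0 x \<bullet> a > 0"
      unfolding ga[OF D(1)] using pos[OF D(1,3)] \<open>h > 0\<close> by (intro mult_pos_pos[OF \<sigma>(1)]) simp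
    show "grad_at \<phi> \<alpha>0 x \<bullet> b > 0"
      unfolding gb[OF D(1)] using neg[OF D(1,2)] \<open>h > 0\<close> by (intro mult_pos_pos[OF \<sigma>(1)]) simp
    fix \<alpha> assume \<alpha>: "(\<alpha>, x) \<in> D" "\<bar>\<alpha> - \<alpha>0\<bar> > h"
    have "sin (T (\<alpha>0 + h) - T \<alpha>) * sin (T (\<alpha>0 - h) - T \<alpha>) > 0"
    proof (cases "\<alpha> < \<alpha>0")
      case True
      with \<alpha> \<open>h > 0\<close> have "\<alpha> < \<alpha>0 - h" "\<alpha> < \<alpha>0 + h" by linarith+
      then show ?thesis by (intro mult_pos_pos pos \<alpha>(1) D(2,3))
    next
      case False
      with \<alpha> \<open>h > 0\<close> have "\<alpha>0 - h < \<alpha>" "\<alpha>0 + h < \<alpha>" by linarith+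
      then show ?thesis by (intro mult_neg_neg neg \<alpha>(1) D(2,3))
    qed
    moreover have "(r \<alpha> * \<sigma>)\<^sup>2 > 0"
      using r[OF \<alpha>(1)] \<sigma> by (simp add: power_mult_distrib)
    moreover have "(grad_at \<phi> \<alpha> x \<bullet> a) * (grad_at \<phi> \<alpha> x \<bullet> b) =
        - ((r \<alpha> * \<sigma>)\<^sup>2 * (sin (T (\<alpha>0 + h) - T \<alpha>) * sin (T (\<alpha>0 - h) - T \<alpha>)))"
      unfolding ga[OF \<alpha>(1)] gb[OF \<alpha>(1)] power2_eq_square by simp
    ultimately show "(grad_at \<phi> \<alpha> x \<bullet> a) * (grad_at \<phi> \<alpha> x \<bullet> b) < 0"
      by (simp only: neg_less_0_iff_less mult_pos_pos)
  qed
qed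

section \<open>Continuity of the gradient and of the function\<close>

lemma C1_on_continuous_on_grad_at:
  assumes "C1_on D \<phi>"
  shows "continuous_on D (\<lambda>p. grad_at \<phi> (fst p) (snd p))"
proof -
  obtain f' where f': "\<And>p. p \<in> D \<Longrightarrow> (\<phi> has_derivative blinfun_apply (f' p)) (at p)"
    and cont: "continuous_on D f'"
    using assms unfolding C1_on_def by blast
  have "grad_at \<phi> (fst p) (snd p) = (blinfun_apply (f' p) (0, 1, 0), blinfun_apply (f' p) (0, 0, 1))"
    if p: "p \<in> D" for p
  proof -
    obtain \<alpha> x where px: "p = (\<alpha>, x)" by (cases p)
    have "((\<lambda>y. (\<alpha>, y)) has_derivative (\<lambda>h. (0, h))) (at x)"
      by (auto intro!: derivative_eq_intros)
    then have "(curry \<phi> \<alpha> has_derivative (\<lambda>h. blinfun_apply (f' p) (0, h))) (at x)"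
      using has_derivative_compose[of "\<lambda>y. (\<alpha>, y)" "\<lambda>h. (0, h)" x UNIV \<phi>] f'[OF p]
      by (simp add: curry_def px)
    moreover have "(curry \<phi> \<alpha> has_derivative (\<lambda>h. h \<bullet> grad_at \<phi> \<alpha> x)) (at x)"
      using C1_on_GDERIV_grad_at[OF assms] p unfolding px gderiv_def by blast
    ultimately have "(\<lambda>h. h \<bullet> grad_at \<phi> \<alpha> x) = (\<lambda>h. blinfun_apply (f' p) (0, h))"
      by (rule has_derivative_unique[rotated])
    then have "h \<bullet> grad_at \<phi> \<alpha> x = blinfun_apply (f' p) (0, h)" for h
      by (rule fun_cong)
    from this[of "(1, 0)"] this[of "(0, 1)"] show ?thesis
      by (simp add: px prod_eq_iff inner_prod_def)
  qed
  moreover have "continuous_on D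
      (\<lambda>p. (blinfun_apply (f' p) (0, 1, 0), blinfun_apply (f' p) (0, 0, 1)))"
    by (intro continuous_intros cont)
  ultimately show ?thesis
    by (simp cong: continuous_on_cong)
qed

lemma C1_on_continuous_on:
  assumes "C1_on D \<phi>" shows "continuous_on D \<phi>"
  using assms unfolding C1_on_def
  by (metis continuous_at_imp_continuous_on has_derivative_continuous)

section \<open>Venetian blinds\<close>

lemma open_nbhd: "open (nbhd e S)"
  unfolding nbhd_def by auto

lemma subset_nbhd: "e > 0 \<Longrightarrow> S \<subseteq> nbhd e S"
  unfolding nbhd_def by auto

lemma nbhd_mono: "d \<le> e \<Longrightarrow> S \<subseteq> T \<Longrightarrow> nbhd d S \<subseteq> nbhd e T"
  unfolding nbhd_def by fastforce

lemma nbhd_UN: "nbhd e (\<Union>i\<in>I. S i) = (\<Union>i\<in>I. nbhd e (S i))"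
  unfolding nbhd_def by auto

lemma closure_nbhd_subset:
  assumes "d < e"
  shows "closure (nbhd d S) \<subseteq> nbhd e S"
proof
  fix x assume "x \<in> closure (nbhd d S)"
  then obtain z where z: "z \<in> nbhd d S" "dist z x < e - d"
    using assms by (metis closure_approachable diff_gt_0_iff_gt)
  then obtain y where y: "y \<in> S" "dist y z < d"
    unfolding nbhd_def by auto
  with z have "dist y x < e"
    using dist_triangle[of y x z] by linarith
  with y show "x \<in> nbhd e S"
    unfolding nbhd_def by auto
qed

text \<open>These are the blinds. \<open>B\<close> will have at most \<open>M\<close> points and
  \<open>v\<close> will be \<open>1 / M\<close> times a fixed vector, so the total length stays
  bounded while the single segments become tiny.\<close>

definition comb :: "'a::real_vector set \<Rightarrow> 'a \<Rightarrow> 'a set" where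
  "comb B v = (\<Union>p\<in>B. closed_segment p (p + v))"

text \<open>Monotonicity for the order given by the cone spanned by \<open>a\<close> and
  \<open>b\<close>. Stated without derivatives, it lets combs be refined by purely order-theoretic
  and connectedness arguments; \<open>increasing_along_if_pos\<close> supplies it from the signs of
  two directional derivatives.\<close>

definition increasing_along ::
    "'a::real_vector \<Rightarrow> 'a \<Rightarrow> 'a set \<Rightarrow> ('a \<Rightarrow> real) \<Rightarrow> bool" where
  "increasing_along a b S f \<longleftrightarrow>
    (\<forall>x u v. 0 \<le> u \<longrightarrow> 0 \<le> v \<longrightarrow> x \<in> S \<longrightarrow> x + u *\<^sub>R a + v *\<^sub>R b \<in> S \<longrightarrow>
      f x \<le> f (x + u *\<^sub>R a + v *\<^sub>R b))"

lemma in_segment_shift: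
  "x \<in> closed_segment p (p + v) \<longleftrightarrow> (\<exists>u. 0 \<le> u \<and> u \<le> 1 \<and> x = p + u *\<^sub>R v)"
  unfolding in_segment by (auto simp: algebra_simps)

lemma ex_subinterval:
  fixes w :: real
  assumes w: "0 \<le> w" "w \<le> 1" and m: "0 < m"
  shows "\<exists>i<m. real i \<le> w * real m \<and> w * real m \<le> real i + 1"
proof (cases "w = 1")
  \<comment> \<open>At \<open>w = 1\<close> the floor would give the index \<open>m\<close>, which
    is out of range.\<close>
  case True
  then show ?thesis using m by (intro exI[of _ "m - 1"]) auto
next
  case False
  then have "w * real m < real m" using w m by simp
  moreover have "0 \<le> w * real m" using w by simp
  ultimately have "nat \<lfloor>w * real m\<rfloor> < m" "real (nat \<lfloor>w * real m\<rfloor>) = of_int \<lfloor>w * real m\<rfloor>"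
    by (simp_all add: nat_less_iff floor_less_iff)
  moreover have "of_int \<lfloor>w * real m\<rfloor> \<le> w * real m" "w * real m \<le> of_int \<lfloor>w * real m\<rfloor> + 1"
    by linarith+
  ultimately show ?thesis by metis
qed

text \<open>
  A segment \<open>[p, p + v]\<close> with \<open>v = a + s b\<close> is cut into \<open>m\<close> pieces, and each piece is rotated about
  its initial point so that its vector becomes a multiple of \<open>a + s' b\<close>. Since the old and the new
  piece differ by positive multiples of \<open>a\<close> and \<open>b\<close>, the new one has a larger image under a function
  increasing along \<open>a\<close> and \<open>b\<close>.
\<close>

lemma comb_refine:
  fixes a b :: "'a::real_normed_vector"
  assumes s: "0 \<le> s" "s \<le> s'" and B: "finite B" "card B \<le> M" "0 < M" and "0 < \<tau>" "0 < \<epsilon>"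
  defines "N \<equiv> nbhd \<tau> (comb B ((1 / real M) *\<^sub>R (a + s *\<^sub>R b)))"
  shows "\<exists>B' M' \<tau>'. finite B' \<and> card B' \<le> M' \<and> 0 < M' \<and> 0 < \<tau>' \<and> \<tau>' \<le> \<epsilon> / real M' \<and>
    nbhd \<tau>' (comb B' ((1 / real M') *\<^sub>R (a + s' *\<^sub>R b))) \<subseteq> N \<and>
    (\<forall>S f. N \<subseteq> S \<longrightarrow> continuous_on S f \<longrightarrow> increasing_along a b S f \<longrightarrow>
      f ` comb B ((1 / real M) *\<^sub>R (a + s *\<^sub>R b)) \<subseteq> f ` comb B' ((1 / real M') *\<^sub>R (a + s' *\<^sub>R b)))"
proof -
  define v v' where "v = a + s *\<^sub>R b" and "v' = a + s' *\<^sub>R b"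
  \<comment> \<open>This makes the new segments shorter than \<open>\<tau> / 2\<close>. Their
    initial points lie on the old comb, so a neighbourhood of radius at most
    \<open>\<tau> / 2\<close> of the new comb stays inside \<open>N\<close>.\<close>
  obtain m :: nat where m: "m > 0" "2 * norm v' / \<tau> < real m"
    using reals_Archimedean2[of "max (2 * norm v' / \<tau>) 0"] by (metis max_less_iff_conj of_nat_0_less_iff)
  define M' where "M' = M * m"
  have M': "0 < M'" "real M' = real M * real m" using B m by (auto simp: M'_def)
  have small: "norm v' / real M' < \<tau> / 2"
  proof -
    have "2 * norm v' < \<tau> * real m"
      using m \<open>0 < \<tau>\<close> by (simp add: pos_divide_less_eq mult.commute)
    also have "\<dots> \<le> \<tau> * real M'"
      unfolding M' using B \<open>0 < \<tau>\<close> m by (intro mult_left_mono) auto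
    finally show ?thesis using M' by (simp add: field_simps)
  qed
  define \<tau>' where "\<tau>' = min (\<tau> / 2) (\<epsilon> / real M')"
  define B' where "B' = (\<lambda>(p, i). p + (real i / real M') *\<^sub>R v) ` (B \<times> {..<m})"
  have "card B' \<le> card (B \<times> {..<m})"
    unfolding B'_def using B by (intro card_image_le) auto
  also have "\<dots> \<le> M'" using B by (simp add: M'_def)
  finally have "card B' \<le> M'" .
  have base: "p + (real i / real M') *\<^sub>R v \<in> comb B ((1 / real M) *\<^sub>R v)"
    if "p \<in> B" "i < m" for p i
  proof -
    have "p + (real i / real M') *\<^sub>R v = p + (real i / real m) *\<^sub>R (1 / real M) *\<^sub>R v"
      unfolding M' by simp
    moreover have "0 \<le> real i / real m" "real i / real m \<le> 1"
      using that m by auto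
    ultimately have "p + (real i / real M') *\<^sub>R v \<in> closed_segment p (p + (1 / real M) *\<^sub>R v)"
      unfolding in_segment_shift by blast
    then show ?thesis
      unfolding comb_def using that by blast
  qed
  have N': "nbhd \<tau>' (comb B' ((1 / real M') *\<^sub>R v')) \<subseteq> N"
  proof
    fix z assume "z \<in> nbhd \<tau>' (comb B' ((1 / real M') *\<^sub>R v'))"
    then obtain p i u where pi: "p \<in> B" "i < m" and u: "0 \<le> u" "u \<le> 1"
      and z: "dist (p + (real i / real M') *\<^sub>R v + u *\<^sub>R (1 / real M') *\<^sub>R v') z < \<tau>'"
      unfolding nbhd_def comb_def B'_def by (auto simp: in_segment_shift)
    define p' where "p' = p + (real i / real M') *\<^sub>R v"
    have "dist p' (p' + u *\<^sub>R (1 / real M') *\<^sub>R v') = u * (norm v' / real M')"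
      using u M' by (simp add: dist_norm)
    also have "\<dots> \<le> norm v' / real M'"
      using u M' by (intro mult_left_le_one_le) auto
    finally have "dist p' (p' + u *\<^sub>R (1 / real M') *\<^sub>R v') \<le> norm v' / real M'" .
    moreover have "dist (p' + u *\<^sub>R (1 / real M') *\<^sub>R v') z < \<tau> / 2"
      using z by (simp add: \<tau>'_def p'_def)
    ultimately have "dist p' z < \<tau>"
      using small dist_triangle[of p' z "p' + u *\<^sub>R (1 / real M') *\<^sub>R v'"] by linarith
    then show "z \<in> N"
      using base[OF pi] unfolding N_def nbhd_def v_def p'_def by auto
  qed
  have cov: "f ` comb B ((1 / real M) *\<^sub>R v) \<subseteq> f ` comb B' ((1 / real M') *\<^sub>R v')"
    if S: "N \<subseteq> S" "continuous_on S f" "increasing_along a b S f" for S f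
  proof
    fix r assume "r \<in> f ` comb B ((1 / real M) *\<^sub>R v)"
    then obtain p w where p: "p \<in> B" and w: "0 \<le> w" "w \<le> 1"
      and r: "r = f (p + w *\<^sub>R (1 / real M) *\<^sub>R v)"
      unfolding comb_def by (auto simp: in_segment_shift)
    obtain i where i: "i < m" "real i \<le> w * real m" "w * real m \<le> real i + 1"
      using ex_subinterval[of w m] w m by blast
    define t where "t = w * real m - real i"
    have t: "0 \<le> t" "t \<le> 1" using i by (auto simp: t_def)
    define p' where "p' = p + (real i / real M') *\<^sub>R v"
    \<comment> \<open>\<open>x\<close> is the given point of the old piece, \<open>p'\<close> and
      \<open>y\<close> are the ends of the new one. The steps from \<open>p'\<close> to
      \<open>x\<close> and from \<open>x\<close> to \<open>y\<close> have nonnegative coefficients,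
      the latter because \<open>t * s \<le> s'\<close>. So the value at \<open>x\<close> lies
      between the values at the ends, and the new segment attains it by connectedness.\<close>
    define x where "x = p' + (t / real M') *\<^sub>R a + (t * s / real M') *\<^sub>R b"
    define y where "y = x + ((1 - t) / real M') *\<^sub>R a + ((s' - t * s) / real M') *\<^sub>R b"
    have x: "x = p + w *\<^sub>R (1 / real M) *\<^sub>R v"
    proof -
      have "x = p + (real i / real M' + t / real M') *\<^sub>R v"
        unfolding x_def p'_def v_def by (simp add: algebra_simps)
      also have "real i / real M' + t / real M' = w * (1 / real M)"
        using M' m B by (simp add: t_def field_simps)
      finally show ?thesis by simp
    qed
    have y: "y = p' + (1 / real M') *\<^sub>R v'"
    proof -
      have "y = p' + (t / real M' + (1 - t) / real M') *\<^sub>R a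
          + (t * s / real M' + (s' - t * s) / real M') *\<^sub>R b"
        unfolding y_def x_def by (simp add: algebra_simps)
      also have "\<dots> = p' + (1 / real M') *\<^sub>R a + (s' / real M') *\<^sub>R b"
        by (simp add: add_divide_distrib[symmetric])
      finally show ?thesis by (simp add: v'_def algebra_simps)
    qed
    have p'B: "p' \<in> B'" unfolding B'_def p'_def using p i by auto
    have sub: "closed_segment p' y \<subseteq> comb B' ((1 / real M') *\<^sub>R v')"
      unfolding comb_def y using p'B by auto
    moreover have "comb B' ((1 / real M') *\<^sub>R v') \<subseteq> S"
      using N' subset_nbhd[of \<tau>'] S(1) \<open>0 < \<tau>\<close> \<open>0 < \<epsilon>\<close> M' by (fastforce simp: \<tau>'_def)
    ultimately have segS: "closed_segment p' y \<subseteq> S" by blast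
    have "x \<in> comb B ((1 / real M) *\<^sub>R v)"
      unfolding x comb_def using p w by (auto simp: in_segment_shift)
    then have xS: "x \<in> S"
      using S(1) subset_nbhd[OF \<open>0 < \<tau>\<close>] unfolding N_def v_def by blast
    have "t * s \<le> s'" using t s by (meson mult_left_le_one_le order_trans)
    then have "f p' \<le> f x" "f x \<le> f y"
      using S(3) t s M' segS xS unfolding increasing_along_def x_def y_def by auto
    moreover have "connected (f ` closed_segment p' y)"
      by (intro connected_continuous_image continuous_on_subset[OF S(2) segS]) simp
    ultimately have "f x \<in> f ` closed_segment p' y"
      by (meson connectedD_interval ends_in_segment(1,2) imageI)
    then show "r \<in> f ` comb B' ((1 / real M') *\<^sub>R v')"
      using sub r x by auto
  qed
  show ?thesis
    using \<open>card B' \<le> M'\<close> M' N' cov B \<open>0 < \<tau>\<close> \<open>0 < \<epsilon>\<close> unfolding v_def v'_def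
    by (intro exI[of _ B'] exI[of _ M'] exI[of _ \<tau>'])
      (auto simp: \<tau>'_def B'_def)
qed

text \<open>Dependent choice over \<open>comb_refine\<close> along the slopes \<open>s k\<close>,
  starting from a single segment. Since the neighbourhoods are nested, a late stage still lies close
  to each earlier one. The bound \<open>\<epsilon> / M\<close> on the radius keeps the radii of the
  at most \<open>M\<close> pieces summing to at most \<epsilon>.\<close>

lemma comb_sequence:
  fixes a b :: "'a::real_normed_vector"
  assumes s: "0 \<le> s 0" "incseq s" and "0 < \<tau>0" "0 < \<epsilon>"
  obtains B M \<tau> where
    "\<And>k. finite (B k)" "\<And>k. card (B k) \<le> M k" "\<And>k. 0 < M k"
    "\<And>k. 0 < \<tau> k" "\<And>k. \<tau> k \<le> \<epsilon> / real (M k)"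
    "antimono (\<lambda>k. nbhd (\<tau> k) (comb (B k) ((1 / real (M k)) *\<^sub>R (a + s k *\<^sub>R b))))"
    "nbhd (\<tau> 0) (comb (B 0) ((1 / real (M 0)) *\<^sub>R (a + s 0 *\<^sub>R b)))
      \<subseteq> nbhd \<tau>0 (closed_segment p (p + (a + s 0 *\<^sub>R b)))"
    "\<And>k S f. nbhd \<tau>0 (closed_segment p (p + (a + s 0 *\<^sub>R b))) \<subseteq> S \<Longrightarrow> continuous_on S f \<Longrightarrow>
      increasing_along a b S f \<Longrightarrow>
      f ` closed_segment p (p + (a + s 0 *\<^sub>R b))
        \<subseteq> f ` comb (B k) ((1 / real (M k)) *\<^sub>R (a + s k *\<^sub>R b))"
proof -
  define C where "C k X = (case X of (B, M, \<tau>) \<Rightarrow> comb B ((1 / real M) *\<^sub>R (a + s k *\<^sub>R b)))"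
    for k :: nat and X :: "'a set \<times> nat \<times> real"
  define N where "N k X = (case X of (B, M, \<tau>) \<Rightarrow> nbhd \<tau> (C k X))"
    for k :: nat and X :: "'a set \<times> nat \<times> real"
  \<comment> \<open>The clause for \<open>k = 0\<close> records the initial comb, about which
    dependent choice would otherwise say nothing.\<close>
  define P where "P k X \<longleftrightarrow> (case X of (B, M, \<tau>) \<Rightarrow>
      finite B \<and> card B \<le> M \<and> 0 < M \<and> 0 < \<tau> \<and> \<tau> \<le> \<epsilon> / real M \<and>
      (k = 0 \<longrightarrow> B = {p} \<and> M = 1 \<and> \<tau> \<le> \<tau>0))"
    for k :: nat and X :: "'a set \<times> nat \<times> real"
  define Q where "Q k X Y \<longleftrightarrow> N (Suc k) Y \<subseteq> N k X \<and>
      (\<forall>S f. N k X \<subseteq> S \<longrightarrow> continuous_on S f \<longrightarrow> increasing_along a b S f \<longrightarrow>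
        f ` C k X \<subseteq> f ` C (Suc k) Y)"
    for k :: nat and X Y :: "'a set \<times> nat \<times> real"
  have s_nonneg: "0 \<le> s k" for k
    using s by (meson incseqD le0 order_trans)
  have "\<exists>X. \<forall>k. P k (X k) \<and> Q k (X k) (X (Suc k))"
  proof (rule dependent_nat_choice)
    show "\<exists>X. P 0 X"
      using assms by (intro exI[of _ "({p}, 1, min \<tau>0 \<epsilon>)"]) (auto simp: P_def)
  next
    fix X k assume "P k X"
    moreover obtain B M \<tau> where X: "X = (B, M, \<tau>)" by (cases X)
    ultimately have "finite B" "card B \<le> M" "0 < M" "0 < \<tau>" by (auto simp: P_def)
    from comb_refine[OF s_nonneg[of k] incseq_SucD[OF s(2), of k] this \<open>0 < \<epsilon>\<close>, of a b]
    obtain B' M' \<tau>' where "P (Suc k) (B', M', \<tau>')" "Q k X (B', M', \<tau>')"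
      unfolding P_def Q_def N_def C_def X by auto
    then show "\<exists>Y. P (Suc k) Y \<and> Q k X Y" by blast
  qed
  then obtain X where P: "\<And>k. P k (X k)" and Q: "\<And>k. Q k (X k) (X (Suc k))" by blast
  obtain \<tau> where X0: "X 0 = ({p}, 1, \<tau>)" "\<tau> \<le> \<tau>0"
    using P[of 0] by (cases "X 0") (auto simp: P_def)
  have C0: "C 0 (X 0) = closed_segment p (p + (a + s 0 *\<^sub>R b))"
    by (simp add: C_def comb_def X0)
  have N0: "N 0 (X 0) \<subseteq> nbhd \<tau>0 (closed_segment p (p + (a + s 0 *\<^sub>R b)))"
    using nbhd_mono[OF X0(2) order_refl] C0 by (simp add: N_def X0)
  have anti: "antimono (\<lambda>k. N k (X k))"
    using Q unfolding Q_def by (intro decseq_SucI) auto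
  have cov: "f ` closed_segment p (p + (a + s 0 *\<^sub>R b)) \<subseteq> f ` C k (X k)"
    if "nbhd \<tau>0 (closed_segment p (p + (a + s 0 *\<^sub>R b))) \<subseteq> S" "continuous_on S f"
      "increasing_along a b S f" for k S f
  proof (induction k)
    case 0
    show ?case by (simp add: C0)
  next
    case (Suc k)
    have "N k (X k) \<subseteq> S"
      using antimonoD[OF anti, of 0 k] N0 that(1) by auto
    moreover have "\<forall>S f. N k (X k) \<subseteq> S \<longrightarrow> continuous_on S f \<longrightarrow> increasing_along a b S f \<longrightarrow>
        f ` C k (X k) \<subseteq> f ` C (Suc k) (X (Suc k))"
      using Q[of k] unfolding Q_def by (rule conjunct2)
    ultimately have "f ` C k (X k) \<subseteq> f ` C (Suc k) (X (Suc k))"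
      using that(2,3) by metis
    with Suc show ?case by (rule subset_trans)
  qed
  show thesis
  proof
    fix k
    show "finite (fst (X k))" "card (fst (X k)) \<le> fst (snd (X k))" "0 < fst (snd (X k))"
      "0 < snd (snd (X k))" "snd (snd (X k)) \<le> \<epsilon> / real (fst (snd (X k)))"
      using P[of k] by (auto simp: P_def split: prod.splits)
  next
    show "antimono (\<lambda>k. nbhd (snd (snd (X k)))
        (comb (fst (X k)) ((1 / real (fst (snd (X k)))) *\<^sub>R (a + s k *\<^sub>R b))))"
      using anti by (simp add: N_def C_def case_prod_beta)
    show "nbhd (snd (snd (X 0))) (comb (fst (X 0)) ((1 / real (fst (snd (X 0)))) *\<^sub>R (a + s 0 *\<^sub>R b)))
      \<subseteq> nbhd \<tau>0 (closed_segment p (p + (a + s 0 *\<^sub>R b)))"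
      using N0 by (simp add: N_def C_def case_prod_beta)
  next
    fix k S and f :: "'a \<Rightarrow> real"
    assume "nbhd \<tau>0 (closed_segment p (p + (a + s 0 *\<^sub>R b))) \<subseteq> S" "continuous_on S f"
      "increasing_along a b S f"
    from cov[OF this, of k] show "f ` closed_segment p (p + (a + s 0 *\<^sub>R b))
        \<subseteq> f ` comb (fst (X k)) ((1 / real (fst (snd (X k)))) *\<^sub>R (a + s k *\<^sub>R b))"
      by (simp add: C_def case_prod_beta)
  qed
qed

section \<open>Outer measure of images of thin combs\<close>

text \<open>A bound on Lebesgue outer measure, phrased by a Borel cover so that images need not be
  shown measurable.\<close>

definition small :: "real set \<Rightarrow> real \<Rightarrow> bool" where
  "small Y d \<longleftrightarrow> (\<exists>I\<in>sets borel. Y \<subseteq> I \<and> emeasure lborel I \<le> ennreal d)"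

lemma small_subset: "small Y d \<Longrightarrow> X \<subseteq> Y \<Longrightarrow> small X d"
  unfolding small_def by blast

lemma small_mono: "small Y d \<Longrightarrow> d \<le> e \<Longrightarrow> small Y e"
  unfolding small_def by (meson ennreal_leI order_trans)

lemma small_UN:
  assumes "finite I" "\<And>i. i \<in> I \<Longrightarrow> small (Y i) d" "d \<ge> 0"
  shows "small (\<Union>i\<in>I. Y i) (real (card I) * d)"
proof -
  obtain J where J: "\<And>i. i \<in> I \<Longrightarrow> J i \<in> sets borel \<and> Y i \<subseteq> J i \<and> emeasure lborel (J i) \<le> ennreal d"
    using assms(2) unfolding small_def by metis
  have "emeasure lborel (\<Union>i\<in>I. J i) \<le> (\<Sum>i\<in>I. emeasure lborel (J i))"
    using assms(1) J by (intro emeasure_subadditive_finite) auto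
  also have "\<dots> \<le> (\<Sum>i\<in>I. ennreal d)"
    using J by (intro sum_mono) auto
  also have "\<dots> = ennreal (real (card I) * d)"
    using assms(3) by (simp add: ennreal_mult ennreal_of_nat_eq_real_of_nat)
  finally show ?thesis
    using J assms(1) unfolding small_def by (intro bexI[of _ "\<Union>i\<in>I. J i"]) auto
qed

text \<open>The covering interval is centred at an arbitrary point of \<open>Y\<close>, whence the
  factor 2.\<close>

lemma small_if_diameter_le:
  assumes "\<And>x y. x \<in> Y \<Longrightarrow> y \<in> Y \<Longrightarrow> \<bar>x - y\<bar> \<le> d"
  shows "small Y (2 * d)"
proof (cases "Y = {}")
  case True
  then show ?thesis unfolding small_def by (intro bexI[of _ "{}"]) auto
next
  case False
  then obtain x where x: "x \<in> Y" by blast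
  then have "Y \<subseteq> {x - d..x + d}" using assms by (force simp: abs_le_iff)
  moreover have "d \<ge> 0" using assms[OF x x] by simp
  ultimately show ?thesis
    unfolding small_def by (intro bexI[of _ "{x - d..x + d}"]) auto
qed

text \<open>On each piece \<open>f\<close> is almost linear with gradient \<open>g\<close>, and
  \<open>g\<close> is almost orthogonal to the piece. Since length and thickness are both of order
  \<open>1 / M\<close>, the image of a piece has diameter at most a constant over \<open>M\<close>,
  and the at most \<open>M\<close> pieces add up to a multiple of that constant. Its three terms
  come from the error in the slope, from the thickness, and from the linearization.\<close>

lemma small_image_comb:
  fixes f :: "'a::real_inner \<Rightarrow> real"
  assumes B: "finite B" "card B \<le> M" "0 < M" and \<tau>: "0 < \<tau>" "\<tau> \<le> \<epsilon> / real M"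
    and lin: "\<And>x y. x \<in> X \<Longrightarrow> y \<in> X \<Longrightarrow> \<bar>f x - f y - g \<bullet> (x - y)\<bar> \<le> \<epsilon>' * norm (x - y)"
    and "g \<bullet> (a + s' *\<^sub>R b) = 0" "\<bar>s - s'\<bar> \<le> \<eta>" "0 \<le> \<epsilon>'"
    and XN: "X \<subseteq> nbhd \<tau> (comb B ((1 / real M) *\<^sub>R (a + s *\<^sub>R b)))"
  shows "small (f ` X)
    (2 * (\<eta> * norm g * norm b + 2 * \<epsilon> * norm g + \<epsilon>' * (norm (a + s *\<^sub>R b) + 2 * \<epsilon>)))"
proof -
  define d where "d = \<eta> * norm g * norm b + 2 * \<epsilon> * norm g + \<epsilon>' * (norm (a + s *\<^sub>R b) + 2 * \<epsilon>)"
  have "0 < \<epsilon> / real M" using \<tau> by linarith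
  then have \<epsilon>: "0 < \<epsilon>" using B by (simp add: zero_less_divide_iff)
  have "0 \<le> \<eta>" using assms by linarith
  then have d: "0 \<le> d" using \<epsilon> \<open>0 \<le> \<epsilon>'\<close> by (simp add: d_def)
  define v where "v = (1 / real M) *\<^sub>R (a + s *\<^sub>R b)"
  have piece: "\<bar>f x - f y\<bar> \<le> d / real M"
    if "x \<in> X" "y \<in> X" and xy: "x \<in> nbhd \<tau> (closed_segment p (p + v))"
      "y \<in> nbhd \<tau> (closed_segment p (p + v))" for p x y
  proof -
    obtain u where u: "0 \<le> u" "u \<le> 1" "dist (p + u *\<^sub>R v) x < \<tau>"
      using xy(1) unfolding nbhd_def by (auto simp: in_segment_shift)
    obtain w where w: "0 \<le> w" "w \<le> 1" "dist (p + w *\<^sub>R v) y < \<tau>"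
      using xy(2) unfolding nbhd_def by (auto simp: in_segment_shift)
    \<comment> \<open>The part of \<open>x - y\<close> due to the thickness; what remains is
      parallel to the piece.\<close>
    define e where "e = (x - y) - (u - w) *\<^sub>R v"
    have "e = (x - (p + u *\<^sub>R v)) - (y - (p + w *\<^sub>R v))"
      by (simp add: e_def algebra_simps)
    then have "norm e \<le> norm (x - (p + u *\<^sub>R v)) + norm (y - (p + w *\<^sub>R v))"
      by (metis norm_triangle_ineq4)
    then have e: "norm e \<le> 2 * \<epsilon> / real M"
      using u(3) w(3) \<tau>(2) by (simp add: dist_norm norm_minus_commute)
    have xye: "x - y = (u - w) *\<^sub>R v + e" by (simp add: e_def)
    have uw: "\<bar>u - w\<bar> \<le> 1" using u w by auto
    have "norm (x - y) \<le> \<bar>u - w\<bar> * norm v + norm e"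
      unfolding xye by (metis norm_scaleR norm_triangle_ineq)
    also have "\<dots> \<le> norm v + 2 * \<epsilon> / real M"
      using uw e by (intro add_mono mult_left_le_one_le) auto
    also have "\<dots> = (norm (a + s *\<^sub>R b) + 2 * \<epsilon>) / real M"
      using B by (simp add: v_def add_divide_distrib)
    finally have nxy: "norm (x - y) \<le> (norm (a + s *\<^sub>R b) + 2 * \<epsilon>) / real M" .
    have "a + s *\<^sub>R b = (a + s' *\<^sub>R b) + (s - s') *\<^sub>R b" by (simp add: algebra_simps)
    then have "g \<bullet> (a + s *\<^sub>R b) = (s - s') * (g \<bullet> b)"
      using assms(7) by (metis add_0 inner_add_right inner_scaleR_right)
    then have "\<bar>g \<bullet> (a + s *\<^sub>R b)\<bar> = \<bar>s - s'\<bar> * \<bar>g \<bullet> b\<bar>" by (simp add: abs_mult)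
    also have "\<dots> \<le> \<eta> * (norm g * norm b)"
      using assms(8) \<open>0 \<le> \<eta>\<close> by (intro mult_mono Cauchy_Schwarz_ineq2) auto
    finally have "\<bar>g \<bullet> v\<bar> \<le> \<eta> * (norm g * norm b) / real M"
      using B by (simp add: v_def abs_mult divide_right_mono)
    moreover have "\<bar>u - w\<bar> * \<bar>g \<bullet> v\<bar> \<le> \<bar>g \<bullet> v\<bar>"
      using uw by (intro mult_left_le_one_le) auto
    moreover have "\<bar>g \<bullet> e\<bar> \<le> norm g * (2 * \<epsilon> / real M)"
      using e by (meson Cauchy_Schwarz_ineq2 mult_left_mono norm_ge_zero order_trans)
    moreover have "\<bar>g \<bullet> (x - y)\<bar> \<le> \<bar>u - w\<bar> * \<bar>g \<bullet> v\<bar> + \<bar>g \<bullet> e\<bar>"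
      unfolding xye inner_add_right inner_scaleR_right abs_mult[symmetric] by (rule abs_triangle_ineq)
    ultimately have "\<bar>g \<bullet> (x - y)\<bar> \<le> (\<eta> * norm g * norm b + 2 * \<epsilon> * norm g) / real M"
      by (simp add: add_divide_distrib mult.assoc mult.commute[of "norm g"])
    moreover have "\<bar>f x - f y\<bar> \<le> \<bar>g \<bullet> (x - y)\<bar> + \<epsilon>' * norm (x - y)"
      using lin[OF that(1,2)] by linarith
    moreover have "\<epsilon>' * norm (x - y) \<le> \<epsilon>' * (norm (a + s *\<^sub>R b) + 2 * \<epsilon>) / real M"
      using mult_left_mono[OF nxy \<open>0 \<le> \<epsilon>'\<close>] by simp
    ultimately show ?thesis
      unfolding d_def add_divide_distrib by linarith
  qed
  have "small (f ` (X \<inter> nbhd \<tau> (closed_segment p (p + v)))) (2 * (d / real M))" for p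
    using piece by (intro small_if_diameter_le) auto
  then have "small (\<Union>p\<in>B. f ` (X \<inter> nbhd \<tau> (closed_segment p (p + v)))) (real (card B) * (2 * (d / real M)))"
    using d B by (intro small_UN) auto
  moreover have "f ` X \<subseteq> (\<Union>p\<in>B. f ` (X \<inter> nbhd \<tau> (closed_segment p (p + v))))"
    using XN unfolding comb_def nbhd_UN v_def by blast
  moreover have "real (card B) * (2 * (d / real M)) \<le> real M * (2 * (d / real M))"
    using B d by (intro mult_right_mono) auto
  ultimately show ?thesis
    using B unfolding d_def[symmetric] by (auto intro: small_subset small_mono)
qed

lemma increasing_along_scale:
  assumes "increasing_along a b S f" "0 \<le> c"
  shows "increasing_along (c *\<^sub>R a) (c *\<^sub>R b) S f"
  unfolding increasing_along_def
proof (intro allI impI)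
  fix x u v assume "0 \<le> u" "0 \<le> v" "x \<in> S" "x + u *\<^sub>R c *\<^sub>R a + v *\<^sub>R c *\<^sub>R b \<in> S"
  then show "f x \<le> f (x + u *\<^sub>R c *\<^sub>R a + v *\<^sub>R c *\<^sub>R b)"
    using assms unfolding increasing_along_def scaleR_scaleR by (meson mult_nonneg_nonneg)
qed

text \<open>
  Stage \<open>k\<close> of the construction has slope \<open>k e\<close>. If \<open>g i x\<close> is orthogonal to \<open>a + s b\<close> at one point
  \<open>x\<close> of the piece, then the stage with \<open>k e \<approx> s\<close> has a small image under \<open>f i\<close>, and all later stages
  are contained in a neighbourhood of it.
\<close>

lemma venetian_blind_piece:
  fixes f :: "'i \<Rightarrow> 'a::real_inner \<Rightarrow> real" and g :: "'i \<Rightarrow> 'a \<Rightarrow> 'a"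
  assumes lin: "\<And>i x y z. x \<in> K i \<Longrightarrow> y \<in> ball x r \<Longrightarrow> z \<in> ball x r \<Longrightarrow>
      \<bar>f i y - f i z - g i x \<bullet> (y - z)\<bar> \<le> e * norm (y - z)"
    and G: "\<And>i x. x \<in> K i \<Longrightarrow> norm (g i x) \<le> G"
    and kill: "\<And>i x. i \<in> A \<Longrightarrow> x \<in> K i \<Longrightarrow> x \<in> nbhd \<tau> (closed_segment p (p + c *\<^sub>R a)) \<Longrightarrow>
      \<exists>s. 0 \<le> s \<and> s \<le> S \<and> g i x \<bullet> (a + s *\<^sub>R b) = 0"
    and pos: "0 < e" "e \<le> 1" "0 < c" "0 < \<tau>" "c * norm a + 2 * \<tau> \<le> r" "0 \<le> S" "0 \<le> G"
  obtains V where "open V" "closure V \<subseteq> nbhd \<tau> (closed_segment p (p + c *\<^sub>R a))"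
    "\<And>Y h. nbhd \<tau> (closed_segment p (p + c *\<^sub>R a)) \<subseteq> Y \<Longrightarrow> continuous_on Y h \<Longrightarrow>
      increasing_along a b Y h \<Longrightarrow> h ` closed_segment p (p + c *\<^sub>R a) \<subseteq> h ` V"
    "\<And>i. i \<in> A \<Longrightarrow> small (f i ` (closure V \<inter> K i))
      (2 * c * e * (G * norm b + 2 * G + norm a + S * norm b + 2))"
proof -
  define Q where "Q = G * norm b + 2 * G + norm a + S * norm b + 2"
  define L where "L = closed_segment p (p + c *\<^sub>R a)"
  have "incseq (\<lambda>k. real k * e)" using pos by (auto simp: incseq_def)
  then obtain B M t where
    B: "\<And>k. finite (B k)" "\<And>k. card (B k) \<le> M k" "\<And>k. (0::nat) < M k"
    and t: "\<And>k. 0 < t k" "\<And>k. t k \<le> (c * e) / real (M k)"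
    and anti: "antimono (\<lambda>k. nbhd (t k)
      (comb (B k) ((1 / real (M k)) *\<^sub>R (c *\<^sub>R a + (real k * e) *\<^sub>R c *\<^sub>R b))))"
    and N0: "nbhd (t 0) (comb (B 0) ((1 / real (M 0)) *\<^sub>R (c *\<^sub>R a + (real 0 * e) *\<^sub>R c *\<^sub>R b)))
      \<subseteq> nbhd \<tau> (closed_segment p (p + (c *\<^sub>R a + (real 0 * e) *\<^sub>R c *\<^sub>R b)))"
    and cov: "\<And>k Y h. nbhd \<tau> (closed_segment p (p + (c *\<^sub>R a + (real 0 * e) *\<^sub>R c *\<^sub>R b))) \<subseteq> Y \<Longrightarrow>
      continuous_on Y h \<Longrightarrow> increasing_along (c *\<^sub>R a) (c *\<^sub>R b) Y h \<Longrightarrow>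
      h ` closed_segment p (p + (c *\<^sub>R a + (real 0 * e) *\<^sub>R c *\<^sub>R b))
        \<subseteq> h ` comb (B k) ((1 / real (M k)) *\<^sub>R (c *\<^sub>R a + (real k * e) *\<^sub>R c *\<^sub>R b))"
    using pos by (elim comb_sequence[of "\<lambda>k. real k * e" \<tau> "c * e" "c *\<^sub>R a" "c *\<^sub>R b" p, rotated 1]) auto
  define C where "C k = comb (B k) ((1 / real (M k)) *\<^sub>R (c *\<^sub>R a + (real k * e) *\<^sub>R c *\<^sub>R b))" for k
  \<comment> \<open>Every slope in \<open>[0, S]\<close> is within \<open>e\<close> of the slope of
    one of the stages \<open>0\<close> to \<open>n\<close>, so stage \<open>n\<close> is the final
    one. The radius is halved in \<open>V\<close> so that even the closure of \<open>V\<close> stays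
    inside the neighbourhoods of all these stages.\<close>
  define n where "n = nat \<lfloor>S / e\<rfloor>"
  define V where "V = nbhd (t n / 2) (C n)"
  have V: "closure V \<subseteq> nbhd (t k) (C k)" if "k \<le> n" for k
  proof -
    have "closure V \<subseteq> nbhd (t n) (C n)"
      unfolding V_def using t(1)[of n] by (intro closure_nbhd_subset) simp
    also have "\<dots> \<subseteq> nbhd (t k) (C k)"
      using antimonoD[OF anti that] by (simp add: C_def)
    finally show ?thesis .
  qed
  have VL: "closure V \<subseteq> nbhd \<tau> L"
    using V[of 0] N0 by (simp add: C_def L_def)
  have CV: "C n \<subseteq> V"
    unfolding V_def using t(1)[of n] by (intro subset_nbhd) simp
  show thesis
  proof
    show "open V" unfolding V_def by (rule open_nbhd)
    show "closure V \<subseteq> nbhd \<tau> (closed_segment p (p + c *\<^sub>R a))" using VL by (simp add: L_def)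
  next
    fix Y and h :: "'a \<Rightarrow> real"
    assume "nbhd \<tau> (closed_segment p (p + c *\<^sub>R a)) \<subseteq> Y" "continuous_on Y h" "increasing_along a b Y h"
    then have "h ` closed_segment p (p + c *\<^sub>R a) \<subseteq> h ` C n"
      using cov[of Y h n] increasing_along_scale[of a b Y h c] pos by (simp add: C_def)
    with CV show "h ` closed_segment p (p + c *\<^sub>R a) \<subseteq> h ` V" by blast
  next
    fix i assume i: "i \<in> A"
    show "small (f i ` (closure V \<inter> K i)) (2 * c * e * (G * norm b + 2 * G + norm a + S * norm b + 2))"
    proof (cases "closure V \<inter> K i = {}")
      case True
      have "small ((\<lambda>_. 0) ` ({} :: real set)) 0"
        unfolding small_def by (intro bexI[of _ "{}"]) auto
      then show ?thesis unfolding True using pos by (auto elim: small_mono)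
    next
      case False
      then obtain x where x: "x \<in> K i" "x \<in> closure V" by blast
      then obtain s where s: "0 \<le> s" "s \<le> S" "g i x \<bullet> (a + s *\<^sub>R b) = 0"
        using kill[OF i] VL unfolding L_def by blast
      define k where "k = nat \<lfloor>s / e\<rfloor>"
      have k: "real k * e \<le> s" "s \<le> real k * e + e"
      proof -
        have "real k = of_int \<lfloor>s / e\<rfloor>" using s pos by (simp add: k_def)
        then have "real k \<le> s / e" "s / e \<le> real k + 1" by linarith+
        then show "real k * e \<le> s" "s \<le> real k * e + e"
          using pos by (simp_all add: pos_le_divide_eq pos_divide_le_eq algebra_simps)
      qed
      have "k \<le> n"
        unfolding k_def n_def using s pos by (intro nat_mono floor_mono divide_right_mono) auto
      \<comment> \<open>The distance from \<open>x\<close> to any point of the closure is below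
        \<open>c * norm a + 2 * \<tau> \<le> r\<close>, so the linearization at the single point
        \<open>x\<close> is valid on the whole blind.\<close>
      have ball: "closure V \<subseteq> ball x r"
      proof
        fix y assume "y \<in> closure V"
        then obtain y' where y': "y' \<in> L" "dist y' y < \<tau>"
          using VL unfolding nbhd_def by auto
        obtain x' where x': "x' \<in> L" "dist x' x < \<tau>"
          using x VL unfolding nbhd_def by auto
        obtain u w where uw: "x' = p + u *\<^sub>R c *\<^sub>R a" "y' = p + w *\<^sub>R c *\<^sub>R a"
            "0 \<le> u" "u \<le> 1" "0 \<le> w" "w \<le> 1"
          using x' y' unfolding L_def in_segment_shift by blast
        have "x' - y' = (u - w) *\<^sub>R c *\<^sub>R a" unfolding uw by (simp add: algebra_simps)
        then have "dist x' y' = \<bar>u - w\<bar> * (c * norm a)"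
          using pos by (simp add: dist_norm abs_mult)
        also have "\<dots> \<le> c * norm a"
          using uw pos by (intro mult_left_le_one_le) auto
        finally have "dist x y < r"
          using x' y' pos(5) dist_triangle[of x y x'] dist_triangle[of x' y y'] dist_commute[of x x']
          by linarith
        then show "y \<in> ball x r" by simp
      qed
      have "small (f i ` (closure V \<inter> K i))
        (2 * (e * norm (g i x) * norm (c *\<^sub>R b) + 2 * (c * e) * norm (g i x) +
          e * (norm (c *\<^sub>R a + (real k * e) *\<^sub>R c *\<^sub>R b) + 2 * (c * e))))"
      proof (rule small_image_comb[OF B(1,2,3) t])
        show "closure V \<inter> K i \<subseteq> nbhd (t k)
            (comb (B k) ((1 / real (M k)) *\<^sub>R (c *\<^sub>R a + (real k * e) *\<^sub>R c *\<^sub>R b)))"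
          using V[OF \<open>k \<le> n\<close>] by (auto simp: C_def)
        show "\<bar>f i y - f i z - g i x \<bullet> (y - z)\<bar> \<le> e * norm (y - z)"
          if "y \<in> closure V \<inter> K i" "z \<in> closure V \<inter> K i" for y z
          using that ball by (intro lin x) auto
        have "c *\<^sub>R a + s *\<^sub>R c *\<^sub>R b = c *\<^sub>R (a + s *\<^sub>R b)" by (simp add: algebra_simps)
        then show "g i x \<bullet> (c *\<^sub>R a + s *\<^sub>R c *\<^sub>R b) = 0" using s by simp
        show "\<bar>real k * e - s\<bar> \<le> e" using k by linarith
      qed (use pos in auto)
      moreover have "e * norm (g i x) * norm (c *\<^sub>R b) \<le> c * e * (G * norm b)"
        using mult_right_mono[OF G[OF x(1)], of "c * e * norm b"] pos by (simp add: mult_ac)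
      moreover have "2 * (c * e) * norm (g i x) \<le> c * e * (2 * G)"
        using mult_right_mono[OF G[OF x(1)], of "2 * c * e"] pos by (simp add: mult_ac)
      moreover have "e * (norm (c *\<^sub>R a + (real k * e) *\<^sub>R c *\<^sub>R b) + 2 * (c * e))
          \<le> c * e * (norm a + S * norm b + 2)"
      proof -
        have "norm (c *\<^sub>R a + (real k * e) *\<^sub>R c *\<^sub>R b) \<le> c * norm a + real k * e * (c * norm b)"
          using pos norm_triangle_ineq[of "c *\<^sub>R a" "(real k * e) *\<^sub>R c *\<^sub>R b"] by (simp add: abs_mult)
        also have "real k * e * (c * norm b) \<le> S * (c * norm b)"
          using k s pos by (intro mult_right_mono) auto
        finally have "norm (c *\<^sub>R a + (real k * e) *\<^sub>R c *\<^sub>R b) \<le> c * norm a + S * (c * norm b)"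
          by simp
        moreover have "c * e \<le> c" using pos by simp
        ultimately have "norm (c *\<^sub>R a + (real k * e) *\<^sub>R c *\<^sub>R b) + 2 * (c * e)
            \<le> c * norm a + S * (c * norm b) + 2 * c"
          by linarith
        also have "\<dots> = c * (norm a + S * norm b + 2)"
          by (simp add: algebra_simps)
        finally have "norm (c *\<^sub>R a + (real k * e) *\<^sub>R c *\<^sub>R b) + 2 * (c * e)
            \<le> c * (norm a + S * norm b + 2)" .
        from mult_left_mono[OF this, of e] show ?thesis using pos by (simp add: mult_ac)
      qed
      ultimately show ?thesis
        by (elim small_mono) (simp add: algebra_simps)
    qed
  qed
qed

section \<open>Blinds adapted to an admissible family\<close>

text \<open>\<open>S\<close> is \<open>D\<close> in statements about covering and a compact subset
  of \<open>D\<close> in bounds on the excess.\<close>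

definition shadow ::
    "(real \<times> real \<times> real \<Rightarrow> real) \<Rightarrow> (real \<times> real \<times> real) set \<Rightarrow> (real \<times> real) set \<Rightarrow> (real \<times> real) set"
  where "shadow \<phi> S U = {(\<alpha>, \<phi> (\<alpha>, x)) |\<alpha> x. (\<alpha>, x) \<in> S \<and> x \<in> U}"

lemma shadow_mono: "S \<subseteq> T \<Longrightarrow> U \<subseteq> V \<Longrightarrow> shadow \<phi> S U \<subseteq> shadow \<phi> T V"
  unfolding shadow_def by blast

lemma shadow_UN: "shadow \<phi> S (\<Union>i\<in>I. U i) = (\<Union>i\<in>I. shadow \<phi> S (U i))"
  unfolding shadow_def by blast

text \<open>Tonelli: the uniform bound on slices is integrated over an interval of length
  \<open>2 * R\<close>.\<close>

lemma emeasure_le_of_small_slices: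
  fixes N :: "(real \<times> real) set"
  assumes "N \<in> sets borel" and N: "N \<subseteq> {-R..R} \<times> UNIV"
    and small: "\<And>\<alpha>. small (Pair \<alpha> -` N) d" and "0 \<le> d" "0 \<le> R"
  shows "emeasure lborel N \<le> ennreal (2 * R * d)"
proof -
  have le: "emeasure lborel (Pair \<alpha> -` N) \<le> ennreal d * indicator {-R..R} \<alpha>" for \<alpha>
  proof (cases "\<alpha> \<in> {-R..R}")
    case True
    obtain I where "I \<in> sets borel" "Pair \<alpha> -` N \<subseteq> I" "emeasure lborel I \<le> ennreal d"
      using small[of \<alpha>] unfolding small_def by blast
    then have "emeasure lborel (Pair \<alpha> -` N) \<le> ennreal d"
      using emeasure_mono[of "Pair \<alpha> -` N" I lborel] by (auto intro: order_trans)
    then show ?thesis using True by simp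
  next
    case False
    then have "Pair \<alpha> -` N = {}" using N by auto
    then show ?thesis by simp
  qed
  have "N \<in> sets (lborel \<Otimes>\<^sub>M lborel)"
    using assms(1) by (simp only: lborel_prod sets_lborel)
  then have "emeasure lborel N = (\<integral>\<^sup>+\<alpha>. emeasure lborel (Pair \<alpha> -` N) \<partial>lborel)"
    unfolding lborel_prod[symmetric] by (rule lborel.emeasure_pair_measure_alt)
  also have "\<dots> \<le> (\<integral>\<^sup>+\<alpha>. ennreal d * indicator {-R..R} \<alpha> \<partial>lborel)"
    by (intro nn_integral_mono le)
  also have "\<dots> = ennreal (2 * R * d)"
    using assms by (simp add: nn_integral_cmult_indicator ennreal_mult[symmetric] mult.commute)
  finally show ?thesis .
qed

section \<open>Uniform linearization and tangent slopes on compact sets\<close>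

locale admissible_family =
  fixes D :: "(real \<times> real \<times> real) set" and \<phi> :: "real \<times> real \<times> real \<Rightarrow> real"
  assumes open_D: "open D" and C1: "C1_on D \<phi>"
    and non_stationary: "non_stationary D \<phi>" and monotone: "angle_monotonicity D \<phi>"
begin

abbreviation grad :: "real \<Rightarrow> real \<times> real \<Rightarrow> real \<times> real" where
  "grad \<equiv> grad_at \<phi>"

lemmas cont_\<phi> = C1_on_continuous_on[OF C1]
lemmas cont_grad = C1_on_continuous_on_grad_at[OF C1]

lemma deriv:
  assumes "(\<alpha>, x) \<in> D"
  shows "((\<lambda>x. \<phi> (\<alpha>, x)) has_derivative (\<lambda>h. h \<bullet> grad \<alpha> x)) (at x)"
  using C1_on_GDERIV_grad_at[OF C1 assms] by (simp add: gderiv_def curry_def)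

text \<open>The gradient is uniformly continuous on a compact thickening of \<open>K\<close> inside
  \<open>D\<close>. On a small ball the function minus its linear part at the centre therefore has
  gradient of norm at most \<open>e\<close>, and the mean value inequality applies.\<close>

lemma uniform_linearization:
  assumes K: "compact K" "K \<subseteq> D" and "0 < e"
  obtains r where "0 < r"
    "\<And>\<alpha> x y z. (\<alpha>, x) \<in> K \<Longrightarrow> y \<in> ball x r \<Longrightarrow> z \<in> ball x r \<Longrightarrow>
      \<bar>\<phi> (\<alpha>, y) - \<phi> (\<alpha>, z) - grad \<alpha> x \<bullet> (y - z)\<bar> \<le> e * norm (y - z)"
proof -
  obtain d where d: "d > 0" "(\<Union>p\<in>K. cball p d) \<subseteq> D"
    using compact_subset_open_imp_cball_epsilon_subset[OF K(1) open_D K(2)] by blast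
  have "compact (\<Union>p\<in>K. cball p d)" by (rule compact_minkowski_sum_cball[OF K(1)])
  then have "uniformly_continuous_on (\<Union>p\<in>K. cball p d) (\<lambda>p. grad (fst p) (snd p))"
    by (intro compact_uniformly_continuous continuous_on_subset[OF cont_grad d(2)])
  then obtain d' where d': "d' > 0"
    "\<And>p q. p \<in> (\<Union>p\<in>K. cball p d) \<Longrightarrow> q \<in> (\<Union>p\<in>K. cball p d) \<Longrightarrow> dist q p < d' \<Longrightarrow>
      dist (grad (fst q) (snd q)) (grad (fst p) (snd p)) < e"
    using \<open>0 < e\<close> unfolding uniformly_continuous_on_def by metis
  define r where "r = min d d'"
  show thesis
  proof
    show "r > 0" using d d' by (simp add: r_def)
    fix \<alpha> x y z assume K: "(\<alpha>, x) \<in> K" and yz: "y \<in> ball x r" "z \<in> ball x r"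
    have near: "(\<alpha>, w) \<in> D" "norm (grad \<alpha> w - grad \<alpha> x) \<le> e" if "w \<in> ball x r" for w
    proof -
      have "dist (\<alpha>, x) (\<alpha>, w) < r" using that by (simp add: dist_Pair_Pair)
      then have w: "(\<alpha>, w) \<in> (\<Union>p\<in>K. cball p d)" using K by (force simp: r_def)
      then show "(\<alpha>, w) \<in> D" using d by blast
      have "(\<alpha>, x) \<in> (\<Union>p\<in>K. cball p d)" using K d(1) by (intro UN_I[of "(\<alpha>, x)"]) auto
      moreover have "dist (\<alpha>, w) (\<alpha>, x) < d'"
        using \<open>dist (\<alpha>, x) (\<alpha>, w) < r\<close> by (simp add: r_def dist_commute)
      ultimately have "dist (grad \<alpha> w) (grad \<alpha> x) < e"
        using d'(2)[of "(\<alpha>, x)" "(\<alpha>, w)"] w by simp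
      then show "norm (grad \<alpha> w - grad \<alpha> x) \<le> e"
        by (simp add: dist_norm)
    qed
    have "norm ((\<phi> (\<alpha>, y) - grad \<alpha> x \<bullet> y) - (\<phi> (\<alpha>, z) - grad \<alpha> x \<bullet> z)) \<le> e * norm (y - z)"
    proof (rule differentiable_bound[of "ball x r" _ "\<lambda>w h. h \<bullet> (grad \<alpha> w - grad \<alpha> x)"])
      fix w assume w: "w \<in> ball x r"
      have "((\<lambda>y. \<phi> (\<alpha>, y) - grad \<alpha> x \<bullet> y) has_derivative
          (\<lambda>h. h \<bullet> grad \<alpha> w - grad \<alpha> x \<bullet> h)) (at w within ball x r)"
        by (intro has_derivative_diff has_derivative_at_withinI[OF deriv[OF near(1)[OF w]]])
          (auto intro!: derivative_eq_intros)
      then show "((\<lambda>y. \<phi> (\<alpha>, y) - grad \<alpha> x \<bullet> y) has_derivative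
          (\<lambda>h. h \<bullet> (grad \<alpha> w - grad \<alpha> x))) (at w within ball x r)"
        by (simp add: inner_diff_right inner_commute)
      show "onorm (\<lambda>h. h \<bullet> (grad \<alpha> w - grad \<alpha> x)) \<le> e"
      proof (rule onorm_bound)
        fix h
        have "norm (h \<bullet> (grad \<alpha> w - grad \<alpha> x)) \<le> norm h * norm (grad \<alpha> w - grad \<alpha> x)"
          using Cauchy_Schwarz_ineq2[of h "grad \<alpha> w - grad \<alpha> x"] by simp
        also have "\<dots> \<le> norm h * e" using near(2)[OF w] by (intro mult_left_mono) auto
        finally show "norm (h \<bullet> (grad \<alpha> w - grad \<alpha> x)) \<le> e * norm h" by (simp add: mult.commute)
      qed (use \<open>0 < e\<close> in simp)
    qed (use yz in auto)
    then show "\<bar>\<phi> (\<alpha>, y) - \<phi> (\<alpha>, z) - grad \<alpha> x \<bullet> (y - z)\<bar> \<le> e * norm (y - z)"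
      by (simp add: inner_diff_right algebra_simps)
  qed
qed

text \<open>The slope at which \<open>a + s b\<close> becomes tangent to a level curve is the
  negative of the quotient of the derivatives along \<open>a\<close> and \<open>b\<close>, which is
  positive when these have opposite signs. Compactness spreads the sign condition from
  \<open>x0\<close> to a ball and bounds the slope there.\<close>

lemma killing_direction:
  assumes K: "compact K" "K \<subseteq> D"
    and neg: "\<And>\<alpha>. (\<alpha>, x0) \<in> K \<Longrightarrow> \<bar>\<alpha> - \<alpha>0\<bar> \<ge> h \<Longrightarrow> (grad \<alpha> x0 \<bullet> a) * (grad \<alpha> x0 \<bullet> b) < 0"
  obtains \<rho> S where "0 < \<rho>" "0 \<le> S"
    "\<And>\<alpha> x. (\<alpha>, x) \<in> K \<Longrightarrow> \<bar>\<alpha> - \<alpha>0\<bar> \<ge> h \<Longrightarrow> x \<in> ball x0 \<rho> \<Longrightarrow>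
      \<exists>s. 0 \<le> s \<and> s \<le> S \<and> grad \<alpha> x \<bullet> (a + s *\<^sub>R b) = 0"
proof -
  have cont: "continuous_on K (\<lambda>p. grad (fst p) (snd p))"
    by (rule continuous_on_subset[OF cont_grad K(2)])
  define P where "P p = (grad (fst p) (snd p) \<bullet> a) * (grad (fst p) (snd p) \<bullet> b)" for p
  have contP: "continuous_on K P"
    unfolding P_def by (intro continuous_intros cont)
  \<comment> \<open>The points where the sign condition fails. Their projection to the plane is
    compact and misses \<open>x0\<close>, hence misses a closed ball about
    \<open>x0\<close>.\<close>
  define K1 where "K1 = {p \<in> K. \<bar>fst p - \<alpha>0\<bar> \<ge> h} \<inter> {p \<in> K. P p \<ge> 0}"
  have "closed {p \<in> K. P p \<ge> 0}"
    using continuous_closed_preimage[OF contP compact_imp_closed[OF K(1)], of "{0..}"]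
    by (simp add: vimage_def Int_def)
  moreover have clh: "closed {p::real \<times> real \<times> real. \<bar>fst p - \<alpha>0\<bar> \<ge> h}"
    by (intro closed_Collect_le continuous_intros)
  ultimately have "compact (K \<inter> ({p. \<bar>fst p - \<alpha>0\<bar> \<ge> h} \<inter> {p \<in> K. P p \<ge> 0}))"
    by (intro compact_Int_closed K closed_Int)
  then have "compact K1" by (rule back_subst[of compact]) (auto simp: K1_def)
  then have "closed (snd ` K1)"
    by (intro compact_imp_closed compact_continuous_image continuous_intros)
  moreover have "x0 \<notin> snd ` K1"
    using neg by (force simp: K1_def P_def)
  ultimately obtain \<rho> where \<rho>: "\<rho> > 0" "cball x0 \<rho> \<subseteq> - snd ` K1"
    by (metis ComplI open_Compl open_contains_cball)
  define K2 where "K2 = K \<inter> ({p. \<bar>fst p - \<alpha>0\<bar> \<ge> h} \<inter> snd -` cball x0 \<rho>)"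
  have "compact K2"
    unfolding K2_def by (intro compact_Int_closed K closed_Int clh closed_vimage continuous_intros) auto
  have P2: "P p < 0" if "p \<in> K2" for p
    using that \<rho>(2) unfolding K2_def K1_def by force
  have nz: "grad (fst p) (snd p) \<bullet> b \<noteq> 0" if "p \<in> K2" for p
    using P2[OF that] by (auto simp: P_def)
  define q where "q p = - (grad (fst p) (snd p) \<bullet> a) / (grad (fst p) (snd p) \<bullet> b)" for p
  have "continuous_on K2 q"
    unfolding q_def using nz
    by (intro continuous_intros continuous_on_subset[OF cont]) (auto simp: K2_def)
  then have "bounded (q ` K2)"
    using \<open>compact K2\<close> by (intro compact_imp_bounded compact_continuous_image)
  then obtain S where S: "S > 0" "\<And>p. p \<in> K2 \<Longrightarrow> \<bar>q p\<bar> \<le> S"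
    unfolding bounded_pos by auto
  show thesis
  proof
    show "0 < \<rho>" "0 \<le> S" using \<rho> S by auto
    fix \<alpha> x assume "(\<alpha>, x) \<in> K" "\<bar>\<alpha> - \<alpha>0\<bar> \<ge> h" "x \<in> ball x0 \<rho>"
    then have p: "(\<alpha>, x) \<in> K2" by (auto simp: K2_def)
    have "q (\<alpha>, x) \<ge> 0"
      using P2[OF p] by (auto simp: q_def P_def mult_less_0_iff divide_le_0_iff)
    moreover have "grad \<alpha> x \<bullet> (a + q (\<alpha>, x) *\<^sub>R b) = 0"
      using nz[OF p] by (simp add: q_def inner_diff_right)
    ultimately show "\<exists>s. 0 \<le> s \<and> s \<le> S \<and> grad \<alpha> x \<bullet> (a + s *\<^sub>R b) = 0"
      using S(2)[OF p] by (intro exI[of _ "q (\<alpha>, x)"]) auto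
  qed
qed

text \<open>
  The segment is first cut into parts so short that, for each \<open>\<alpha>\<close>, one stage serves a whole part.
\<close>

lemma venetian_blind:
  assumes K: "compact K" "K \<subseteq> D" and "open Y" "closed_segment q (q + l *\<^sub>R a) \<subseteq> Y"
    and pos: "0 < l" "0 < d" "0 \<le> S"
    and kill: "\<And>\<alpha> x. \<alpha> \<in> A \<Longrightarrow> (\<alpha>, x) \<in> K \<Longrightarrow> x \<in> Y \<Longrightarrow>
      \<exists>s. 0 \<le> s \<and> s \<le> S \<and> grad \<alpha> x \<bullet> (a + s *\<^sub>R b) = 0"
  obtains V where "open V" "closure V \<subseteq> Y"
    "\<And>h. continuous_on Y h \<Longrightarrow> increasing_along a b Y h \<Longrightarrow> h ` closed_segment q (q + l *\<^sub>R a) \<subseteq> h ` V"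
    "\<And>\<alpha>. \<alpha> \<in> A \<Longrightarrow> small ((\<lambda>x. \<phi> (\<alpha>, x)) ` (closure V \<inter> slice K \<alpha>)) d"
proof -
  have "bounded ((\<lambda>p. grad (fst p) (snd p)) ` K)"
    by (intro compact_imp_bounded compact_continuous_image K continuous_on_subset[OF cont_grad])
  then obtain G where "G > 0" and G: "\<And>\<alpha> x. (\<alpha>, x) \<in> K \<Longrightarrow> norm (grad \<alpha> x) \<le> G"
    unfolding bounded_pos by fastforce
  define Q where "Q = G * norm b + 2 * G + norm a + S * norm b + 2"
  have "Q > 0" using \<open>G > 0\<close> pos by (auto simp: Q_def intro!: add_nonneg_pos)
  \<comment> \<open>The number \<open>J\<close> of parts is chosen later, as it depends on
    \<open>r\<close> and thereby on \<open>e\<close>. This is harmless because the total bound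
    \<open>J * (2 * c * e * Q) = 2 * l * e * Q\<close> does not involve \<open>J\<close>.\<close>
  define e where "e = min 1 (d / (2 * l * Q))"
  have e: "0 < e" "e \<le> 1" using pos \<open>Q > 0\<close> by (auto simp: e_def)
  have eQ: "2 * l * e * Q \<le> d"
  proof -
    have "e \<le> d / (2 * l * Q)" by (simp add: e_def)
    then have "e * (2 * l * Q) \<le> d" using pos \<open>Q > 0\<close> by (simp add: pos_le_divide_eq)
    then show ?thesis by (simp add: mult_ac)
  qed
  obtain r where r: "0 < r" "\<And>\<alpha> x y z. (\<alpha>, x) \<in> K \<Longrightarrow> y \<in> ball x r \<Longrightarrow> z \<in> ball x r \<Longrightarrow>
      \<bar>\<phi> (\<alpha>, y) - \<phi> (\<alpha>, z) - grad \<alpha> x \<bullet> (y - z)\<bar> \<le> e * norm (y - z)"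
    using uniform_linearization[OF K e(1)] by blast
  obtain \<tau>1 where \<tau>1: "\<tau>1 > 0" "(\<Union>x\<in>closed_segment q (q + l *\<^sub>R a). ball x \<tau>1) \<subseteq> Y"
    using compact_subset_open_imp_ball_epsilon_subset[OF compact_segment \<open>open Y\<close>] assms(4) by metis
  define \<tau> where "\<tau> = min \<tau>1 (r / 4)"
  obtain J :: nat where J: "J > 0" "2 * (l * norm a) / r < real J"
    using reals_Archimedean2[of "max (2 * (l * norm a) / r) 0"] by (metis max_less_iff_conj of_nat_0_less_iff)
  define c where "c = l / real J"
  have c: "0 < c" "real J * c = l" using J pos by (auto simp: c_def)
  have "c * norm a \<le> r / 2"
    using J r(1) by (simp add: c_def pos_divide_less_eq field_simps)
  then have cr: "c * norm a + 2 * \<tau> \<le> r" using r by (simp add: \<tau>_def)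
  have "\<tau> > 0" using \<tau>1 r by (simp add: \<tau>_def)
  define p where "p j = q + (real j * c) *\<^sub>R a" for j
  have sub: "closed_segment (p j) (p j + c *\<^sub>R a) \<subseteq> closed_segment q (q + l *\<^sub>R a)" if "j < J" for j
  proof
    fix x assume "x \<in> closed_segment (p j) (p j + c *\<^sub>R a)"
    then obtain u where u: "0 \<le> u" "u \<le> 1" "x = p j + u *\<^sub>R c *\<^sub>R a" unfolding in_segment_shift by blast
    have "x = q + ((real j + u) / real J) *\<^sub>R l *\<^sub>R a"
      unfolding u(3) p_def c_def by (simp add: algebra_simps add_divide_distrib)
    moreover have "0 \<le> (real j + u) / real J" "(real j + u) / real J \<le> 1"
      using u that by (auto simp: pos_divide_le_eq)
    ultimately show "x \<in> closed_segment q (q + l *\<^sub>R a)" unfolding in_segment_shift by blast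
  qed
  have nb: "nbhd \<tau> (closed_segment (p j) (p j + c *\<^sub>R a)) \<subseteq> Y" if "j < J" for j
  proof -
    have "nbhd \<tau> (closed_segment (p j) (p j + c *\<^sub>R a)) \<subseteq> nbhd \<tau>1 (closed_segment q (q + l *\<^sub>R a))"
      by (intro nbhd_mono sub that) (simp add: \<tau>_def)
    then show ?thesis using \<tau>1(2) unfolding nbhd_def by blast
  qed
  define piece where "piece j V \<longleftrightarrow> open V \<and> closure V \<subseteq> Y \<and>
      (\<forall>h. continuous_on Y h \<longrightarrow> increasing_along a b Y h \<longrightarrow>
        h ` closed_segment (p j) (p j + c *\<^sub>R a) \<subseteq> h ` V) \<and>
      (\<forall>\<alpha>\<in>A. small ((\<lambda>x. \<phi> (\<alpha>, x)) ` (closure V \<inter> slice K \<alpha>)) (2 * c * e * Q))" for j V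
  have "\<exists>V. piece j V" if j: "j < J" for j
  proof -
    obtain V where "open V" "closure V \<subseteq> nbhd \<tau> (closed_segment (p j) (p j + c *\<^sub>R a))"
      "\<And>Y h. nbhd \<tau> (closed_segment (p j) (p j + c *\<^sub>R a)) \<subseteq> Y \<Longrightarrow> continuous_on Y h \<Longrightarrow>
        increasing_along a b Y h \<Longrightarrow> h ` closed_segment (p j) (p j + c *\<^sub>R a) \<subseteq> h ` V"
      "\<And>\<alpha>. \<alpha> \<in> A \<Longrightarrow> small ((\<lambda>x. \<phi> (\<alpha>, x)) ` (closure V \<inter> slice K \<alpha>))
        (2 * c * e * (G * norm b + 2 * G + norm a + S * norm b + 2))"
    proof (rule venetian_blind_piece[of "slice K" r "\<lambda>\<alpha> x. \<phi> (\<alpha>, x)" grad e G A \<tau> "p j" c a S b])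
      show "\<exists>s\<ge>0. s \<le> S \<and> grad \<alpha> x \<bullet> (a + s *\<^sub>R b) = 0"
        if "\<alpha> \<in> A" "x \<in> slice K \<alpha>" "x \<in> nbhd \<tau> (closed_segment (p j) (p j + c *\<^sub>R a))" for \<alpha> x
        using kill[of \<alpha> x] that nb[OF j] by (auto simp: slice_def)
    qed (use r G e c cr \<open>\<tau> > 0\<close> \<open>G > 0\<close> pos in \<open>auto simp: slice_def\<close>)
    then show ?thesis using nb[OF j] unfolding piece_def Q_def by (intro exI[of _ V]) blast
  qed
  then obtain V where "\<And>j. j < J \<Longrightarrow> piece j (V j)" by metis
  then have V: "\<And>j. j < J \<Longrightarrow> open (V j)" "\<And>j. j < J \<Longrightarrow> closure (V j) \<subseteq> Y"
    and cov: "\<And>j h. j < J \<Longrightarrow> continuous_on Y h \<Longrightarrow> increasing_along a b Y h \<Longrightarrow>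
      h ` closed_segment (p j) (p j + c *\<^sub>R a) \<subseteq> h ` V j"
    and sm: "\<And>j \<alpha>. j < J \<Longrightarrow> \<alpha> \<in> A \<Longrightarrow> small ((\<lambda>x. \<phi> (\<alpha>, x)) ` (closure (V j) \<inter> slice K \<alpha>)) (2 * c * e * Q)"
    unfolding piece_def by blast+
  have "finite I \<Longrightarrow> closure (\<Union>j\<in>I. V j) = (\<Union>j\<in>I. closure (V j))" for I :: "nat set"
    by (induction I rule: finite_induct) auto
  then have cl: "closure (\<Union>j<J. V j) = (\<Union>j<J. closure (V j))"
    by blast
  show thesis
  proof
    show "open (\<Union>j<J. V j)" using V by auto
    show "closure (\<Union>j<J. V j) \<subseteq> Y" unfolding cl using V by auto
  next
    fix h :: "real \<times> real \<Rightarrow> real" assume h: "continuous_on Y h" "increasing_along a b Y h"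
    have "closed_segment q (q + l *\<^sub>R a) \<subseteq> (\<Union>j<J. closed_segment (p j) (p j + c *\<^sub>R a))"
    proof
      fix x assume "x \<in> closed_segment q (q + l *\<^sub>R a)"
      then obtain w where w: "0 \<le> w" "w \<le> 1" "x = q + w *\<^sub>R l *\<^sub>R a" unfolding in_segment_shift by blast
      obtain j where j: "j < J" "real j \<le> w * real J" "w * real J \<le> real j + 1"
        using ex_subinterval[of w J] w J by blast
      have "x = p j + (w * real J - real j) *\<^sub>R c *\<^sub>R a"
        unfolding w(3) p_def c(2)[symmetric] by (simp add: algebra_simps)
      then have "x \<in> closed_segment (p j) (p j + c *\<^sub>R a)"
        unfolding in_segment_shift using j by (intro exI[of _ "w * real J - real j"]) auto
      then show "x \<in> (\<Union>j<J. closed_segment (p j) (p j + c *\<^sub>R a))" using j by blast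
    qed
    then have "h ` closed_segment q (q + l *\<^sub>R a) \<subseteq> (\<Union>j<J. h ` closed_segment (p j) (p j + c *\<^sub>R a))"
      by blast
    also have "\<dots> \<subseteq> (\<Union>j<J. h ` V j)"
      using cov[OF _ h] by (intro UN_mono) auto
    finally show "h ` closed_segment q (q + l *\<^sub>R a) \<subseteq> h ` (\<Union>j<J. V j)"
      by (simp only: image_UN)
  next
    fix \<alpha> assume \<alpha>: "\<alpha> \<in> A"
    have "small (\<Union>j<J. (\<lambda>x. \<phi> (\<alpha>, x)) ` (closure (V j) \<inter> slice K \<alpha>)) (real (card {..<J}) * (2 * c * e * Q))"
      using sm[OF _ \<alpha>] c e \<open>Q > 0\<close> by (intro small_UN) auto
    moreover have "real (card {..<J}) * (2 * c * e * Q) \<le> d"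
      using eQ unfolding c(2)[symmetric] by (simp add: mult_ac)
    moreover have "(\<lambda>x. \<phi> (\<alpha>, x)) ` (closure (\<Union>j<J. V j) \<inter> slice K \<alpha>) =
        (\<Union>j<J. (\<lambda>x. \<phi> (\<alpha>, x)) ` (closure (V j) \<inter> slice K \<alpha>))"
      unfolding cl by blast
    ultimately show "small ((\<lambda>x. \<phi> (\<alpha>, x)) ` (closure (\<Union>j<J. V j) \<inter> slice K \<alpha>)) d"
      by (auto elim: small_mono)
  qed
qed

section \<open>Monotonicity along segments\<close>

lemma along_segment_deriv:
  assumes "(\<alpha>, x + t *\<^sub>R w) \<in> D"
  shows "((\<lambda>t. \<phi> (\<alpha>, x + t *\<^sub>R w)) has_real_derivative w \<bullet> grad \<alpha> (x + t *\<^sub>R w)) (at t)"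
proof -
  have "((\<lambda>t. x + t *\<^sub>R w) has_derivative (\<lambda>h. h *\<^sub>R w)) (at t)"
    by (auto intro!: derivative_eq_intros)
  from has_derivative_compose[OF this deriv[OF assms]] show ?thesis
    by (simp add: has_field_derivative_def mult_commute_abs)
qed

lemma nonneg_along_segment:
  assumes D: "\<And>t. 0 \<le> t \<Longrightarrow> t \<le> 1 \<Longrightarrow> (\<alpha>, x + t *\<^sub>R w) \<in> D \<and> 0 \<le> w \<bullet> grad \<alpha> (x + t *\<^sub>R w)"
  shows "\<phi> (\<alpha>, x) \<le> \<phi> (\<alpha>, x + w)"
proof -
  have "\<exists>y. ((\<lambda>t. \<phi> (\<alpha>, x + t *\<^sub>R w)) has_real_derivative y) (at t) \<and> 0 \<le> y" if "0 \<le> t" "t \<le> 1" for t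
    using along_segment_deriv D[OF that] by blast
  from DERIV_nonneg_imp_nondecreasing[OF zero_le_one this] show ?thesis by simp
qed

lemma pos_along_segment:
  assumes D: "\<And>t. 0 \<le> t \<Longrightarrow> t \<le> 1 \<Longrightarrow> (\<alpha>, x + t *\<^sub>R w) \<in> D \<and> 0 < w \<bullet> grad \<alpha> (x + t *\<^sub>R w)"
  shows "\<phi> (\<alpha>, x) < \<phi> (\<alpha>, x + w)"
proof -
  have "\<exists>y. ((\<lambda>t. \<phi> (\<alpha>, x + t *\<^sub>R w)) has_real_derivative y) (at t) \<and> 0 < y" if "0 \<le> t" "t \<le> 1" for t
    using along_segment_deriv D[OF that] by blast
  from DERIV_pos_imp_increasing[OF zero_less_one this] show ?thesis by simp
qed

text \<open>By convexity the segment between the two points stays in \<open>Y\<close>, and the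
  derivative along it is a nonnegative combination of the derivatives along \<open>a\<close> and
  \<open>b\<close>.\<close>

lemma increasing_along_if_pos:
  assumes "convex Y" "\<And>x. x \<in> Y \<Longrightarrow> (\<alpha>, x) \<in> D \<and> 0 < grad \<alpha> x \<bullet> a \<and> 0 < grad \<alpha> x \<bullet> b"
  shows "increasing_along a b Y (\<lambda>x. \<phi> (\<alpha>, x))"
  unfolding increasing_along_def
proof (intro allI impI)
  fix x u v assume uv: "0 \<le> u" "0 \<le> v" and x: "x \<in> Y" "x + u *\<^sub>R a + v *\<^sub>R b \<in> Y"
  define w where "w = u *\<^sub>R a + v *\<^sub>R b"
  have "x + t *\<^sub>R w \<in> Y" if "0 \<le> t" "t \<le> 1" for t
  proof -
    have "closed_segment x (x + w) \<subseteq> Y"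
      using x \<open>convex Y\<close> unfolding w_def by (intro closed_segment_subset) (auto simp: add.assoc)
    moreover have "x + t *\<^sub>R w \<in> closed_segment x (x + w)"
      using that unfolding in_segment_shift by blast
    ultimately show ?thesis by blast
  qed
  moreover have "0 \<le> w \<bullet> grad \<alpha> y" if "y \<in> Y" for y
    using assms(2)[OF that] uv by (simp add: w_def inner_add_left inner_commute[of "grad \<alpha> y"])
  ultimately have "\<phi> (\<alpha>, x) \<le> \<phi> (\<alpha>, x + w)"
    using assms(2) by (intro nonneg_along_segment) auto
  then show "\<phi> (\<alpha>, x) \<le> \<phi> (\<alpha>, x + u *\<^sub>R a + v *\<^sub>R b)"
    by (simp add: w_def add.assoc)
qed

text \<open>
  The neighbourhood \<open>R\<close> does not depend on \<open>\<epsilon>\<close>, so that the excesses of countably many blinds can be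
  made summable after a countable cover has been chosen.
\<close>

lemma local_venetian_blind:
  assumes p0: "(\<alpha>0, x0) \<in> D" and U: "open U" "x0 \<in> U" and W: "open W" "(\<alpha>0, \<phi> (\<alpha>0, x0)) \<in> W"
    and K: "compact K" "K \<subseteq> D"
  obtains R where "open R" "(\<alpha>0, \<phi> (\<alpha>0, x0)) \<in> R"
    "\<And>\<epsilon>. 0 < \<epsilon> \<Longrightarrow> \<exists>V. open V \<and> compact (closure V) \<and> closure V \<subseteq> U \<and> fst ` R \<times> closure V \<subseteq> D \<and>
      R \<subseteq> shadow \<phi> D V \<and> (\<exists>N\<in>sets borel. shadow \<phi> K V - W \<subseteq> N \<and> emeasure lborel N \<le> ennreal \<epsilon>)"
proof -
  have "continuous_on D (\<lambda>p. (fst p, \<phi> p))"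
    by (intro continuous_intros cont_\<phi>)
  then have "open (D \<inter> (\<lambda>p. (fst p, \<phi> p)) -` W)"
    using continuous_open_preimage open_D W(1) by blast
  then have "open ((D \<inter> (\<lambda>p. (fst p, \<phi> p)) -` W) \<inter> (UNIV \<times> U))"
    by (rule open_Int[OF _ open_Times[OF open_UNIV U(1)]])
  moreover have "(\<alpha>0, x0) \<in> (D \<inter> (\<lambda>p. (fst p, \<phi> p)) -` W) \<inter> (UNIV \<times> U)"
    using p0 U W by auto
  ultimately obtain A1 B1 where AB1: "open A1" "open B1" "(\<alpha>0, x0) \<in> A1 \<times> B1"
    "A1 \<times> B1 \<subseteq> (D \<inter> (\<lambda>p. (fst p, \<phi> p)) -` W) \<inter> (UNIV \<times> U)"
    by (rule open_prod_elim)
  obtain h1 where h1: "h1 > 0" "ball \<alpha>0 h1 \<subseteq> A1"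
    using AB1(1,3) open_contains_ball by blast
  obtain \<rho>1 where \<rho>1: "\<rho>1 > 0" "ball x0 \<rho>1 \<subseteq> B1"
    using AB1(2,3) open_contains_ball by blast
  \<comment> \<open>For parameters closer than \<open>h1\<close> to \<alpha>0 the curves of all
    points of the ball run inside \<open>W\<close> and produce no excess. Only for the remaining
    parameters does the blind have to make the image small.\<close>
  have near: "(\<alpha>, x) \<in> D" "(\<alpha>, \<phi> (\<alpha>, x)) \<in> W" "x \<in> U" if "\<bar>\<alpha> - \<alpha>0\<bar> < h1" "x \<in> ball x0 \<rho>1" for \<alpha> x
  proof -
    have "\<alpha> \<in> A1" using that h1 by (auto simp: dist_real_def abs_minus_commute subset_iff)
    moreover have "x \<in> B1" using that \<rho>1 by blast
    ultimately have "(\<alpha>, x) \<in> A1 \<times> B1" by blast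
    then have "(\<alpha>, x) \<in> (D \<inter> (\<lambda>p. (fst p, \<phi> p)) -` W) \<inter> (UNIV \<times> U)" using AB1(4) by blast
    then show "(\<alpha>, x) \<in> D" "(\<alpha>, \<phi> (\<alpha>, x)) \<in> W" "x \<in> U" by auto
  qed
  \<comment> \<open>Since \<open>h\<close> is strictly below \<open>h1\<close>, the points over
    \<open>x0\<close> at distance \<open>h\<close> from \<alpha>0 lie in \<open>D\<close>, and the
    strict inequality of \<open>transversal_pair\<close> covers the closed range of distances at
    least \<open>h1\<close>, to which compactness applies.\<close>
  define h where "h = h1 / 2"
  have h: "h > 0" "h < h1" using h1 by (auto simp: h_def)
  have D3: "(\<alpha>0 - h, x0) \<in> D" "(\<alpha>0 + h, x0) \<in> D"
    using near(1)[of "\<alpha>0 - h" x0] near(1)[of "\<alpha>0 + h" x0] h \<rho>1 by auto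
  obtain a b where ab: "grad \<alpha>0 x0 \<bullet> a > 0" "grad \<alpha>0 x0 \<bullet> b > 0"
    and neg: "\<And>\<alpha>. (\<alpha>, x0) \<in> D \<Longrightarrow> \<bar>\<alpha> - \<alpha>0\<bar> > h \<Longrightarrow> (grad \<alpha> x0 \<bullet> a) * (grad \<alpha> x0 \<bullet> b) < 0"
    using transversal_pair[OF non_stationary monotone h(1) p0 D3] by metis
  have "continuous_on D (\<lambda>p. (grad (fst p) (snd p) \<bullet> a, grad (fst p) (snd p) \<bullet> b))"
    by (intro continuous_intros cont_grad)
  then have "open (D \<inter> (\<lambda>p. (grad (fst p) (snd p) \<bullet> a, grad (fst p) (snd p) \<bullet> b)) -` ({0<..} \<times> {0<..}))"
    by (rule continuous_open_preimage[OF _ open_D open_Times[OF open_greaterThan open_greaterThan]])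
  moreover have "(\<alpha>0, x0) \<in> (D \<inter> (\<lambda>p. (grad (fst p) (snd p) \<bullet> a, grad (fst p) (snd p) \<bullet> b)) -` ({0<..} \<times> {0<..}))"
    using p0 ab by auto
  ultimately obtain A2 B2 where AB2: "open A2" "open B2" "(\<alpha>0, x0) \<in> A2 \<times> B2"
    "A2 \<times> B2 \<subseteq> D \<inter> (\<lambda>p. (grad (fst p) (snd p) \<bullet> a, grad (fst p) (snd p) \<bullet> b)) -` ({0<..} \<times> {0<..})"
    by (rule open_prod_elim)
  obtain h2 where h2: "h2 > 0" "ball \<alpha>0 h2 \<subseteq> A2"
    using AB2(1,3) open_contains_ball by blast
  obtain \<rho>2 where \<rho>2: "\<rho>2 > 0" "ball x0 \<rho>2 \<subseteq> B2"
    using AB2(2,3) open_contains_ball by blast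
  have negK: "(grad \<alpha> x0 \<bullet> a) * (grad \<alpha> x0 \<bullet> b) < 0" if "(\<alpha>, x0) \<in> K" "\<bar>\<alpha> - \<alpha>0\<bar> \<ge> h1" for \<alpha>
    using neg[of \<alpha>] that K h by auto
  obtain \<rho>3 S where \<rho>3: "0 < \<rho>3" "0 \<le> S"
    and kill: "\<And>\<alpha> x. (\<alpha>, x) \<in> K \<Longrightarrow> \<bar>\<alpha> - \<alpha>0\<bar> \<ge> h1 \<Longrightarrow> x \<in> ball x0 \<rho>3 \<Longrightarrow>
      \<exists>s. 0 \<le> s \<and> s \<le> S \<and> grad \<alpha> x \<bullet> (a + s *\<^sub>R b) = 0"
    using killing_direction[OF K negK] by metis
  define \<rho> where "\<rho> = min (\<rho>1 / 2) (min \<rho>2 \<rho>3)"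
  have \<rho>: "\<rho> > 0" "\<rho> < \<rho>1" "\<rho> \<le> \<rho>2" "\<rho> \<le> \<rho>3" using \<rho>1 \<rho>2 \<rho>3 by (auto simp: \<rho>_def)
  define h' where "h' = min h1 h2"
  have h': "h' > 0" using h1 h2 by (simp add: h'_def)
  have good: "(\<alpha>, x) \<in> D" "0 < grad \<alpha> x \<bullet> a" "0 < grad \<alpha> x \<bullet> b"
    if "\<alpha> \<in> ball \<alpha>0 h'" "x \<in> ball x0 \<rho>" for \<alpha> x
  proof -
    have "\<alpha> \<in> ball \<alpha>0 h2" "x \<in> ball x0 \<rho>2" using that \<rho> by (auto simp: h'_def)
    then have "\<alpha> \<in> A2" "x \<in> B2" using h2 \<rho>2 by blast+
    then have "(\<alpha>, x) \<in> D \<inter> (\<lambda>p. (grad (fst p) (snd p) \<bullet> a, grad (fst p) (snd p) \<bullet> b)) -` ({0<..} \<times> {0<..})"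
      using AB2(4) by blast
    then show "(\<alpha>, x) \<in> D" "0 < grad \<alpha> x \<bullet> a" "0 < grad \<alpha> x \<bullet> b" by auto
  qed
  have mono: "increasing_along a b (ball x0 \<rho>) (\<lambda>x. \<phi> (\<alpha>, x))" if "\<alpha> \<in> ball \<alpha>0 h'" for \<alpha>
    using good[OF that] by (intro increasing_along_if_pos) auto
  have cont: "continuous_on (ball x0 \<rho>) (\<lambda>x. \<phi> (\<alpha>, x))" if "\<alpha> \<in> ball \<alpha>0 h'" for \<alpha>
    using good(1)[OF that]
    by (intro continuous_on_compose2[OF cont_\<phi>] continuous_intros) auto
  define l where "l = \<rho> / (2 * (norm a + 1))"
  have l: "l > 0" "l * norm a < \<rho>"
  proof -
    have "norm a + 1 > 0" using norm_ge_zero[of a] by linarith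
    then show "l > 0" using \<rho> by (simp add: l_def)
    moreover have "norm a < 2 * (norm a + 1)" by (simp add: add_nonneg_pos)
    ultimately have "l * norm a < l * (2 * (norm a + 1))" by (rule mult_strict_left_mono[rotated])
    also have "\<dots> = \<rho>" using \<open>norm a + 1 > 0\<close> by (simp add: l_def)
    finally show "l * norm a < \<rho>" .
  qed
  have seg: "x0 + t *\<^sub>R l *\<^sub>R a \<in> ball x0 \<rho>" if "\<bar>t\<bar> \<le> 1" for t
  proof -
    have "dist x0 (x0 + t *\<^sub>R l *\<^sub>R a) = \<bar>t\<bar> * (l * norm a)"
      using l by (simp add: dist_norm abs_mult)
    also have "\<dots> \<le> l * norm a" using that l by (intro mult_left_le_one_le) auto
    finally show ?thesis using l by simp
  qed
  \<comment> \<open>The segment is centred at \<open>x0\<close>, so that at \<alpha>0 the value at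
    \<open>x0\<close> lies strictly between the values at the two ends.\<close>
  define q where "q = x0 - l *\<^sub>R a"
  have q_seg: "closed_segment q (q + (2 * l) *\<^sub>R a) \<subseteq> ball x0 \<rho>"
  proof
    fix x assume "x \<in> closed_segment q (q + (2 * l) *\<^sub>R a)"
    then obtain u where u: "0 \<le> u" "u \<le> 1" "x = q + u *\<^sub>R (2 * l) *\<^sub>R a"
      unfolding in_segment_shift by blast
    then have "x = x0 + (2 * u - 1) *\<^sub>R l *\<^sub>R a" by (simp add: q_def algebra_simps)
    then show "x \<in> ball x0 \<rho>" using seg[of "2 * u - 1"] u by auto
  qed
  have pm: "x0 - l *\<^sub>R a \<in> ball x0 \<rho>" "x0 + l *\<^sub>R a \<in> ball x0 \<rho>"
    using seg[of "-1"] seg[of 1] by auto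
  define lo hi where "lo \<alpha> = \<phi> (\<alpha>, x0 - l *\<^sub>R a)" and "hi \<alpha> = \<phi> (\<alpha>, x0 + l *\<^sub>R a)" for \<alpha>
  have lohi: "continuous_on (ball \<alpha>0 h') lo" "continuous_on (ball \<alpha>0 h') hi"
    unfolding lo_def hi_def using good(1)[OF _ pm(1)] good(1)[OF _ pm(2)]
    by (intro continuous_on_compose2[OF cont_\<phi>] continuous_intros; auto)+
  \<comment> \<open>The values strictly between those at the ends of the segment are attained on it.
    The blind inherits them from the segment, so \<open>R\<close> is determined by the segment
    alone, before any blind is built.\<close>
  define R where "R = W \<inter> ((ball \<alpha>0 h' \<times> UNIV) \<inter>
    (\<lambda>p. (snd p - lo (fst p), hi (fst p) - snd p)) -` ({0<..} \<times> {0<..}))"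
  have R_iff: "(\<alpha>, s) \<in> R \<longleftrightarrow> (\<alpha>, s) \<in> W \<and> \<alpha> \<in> ball \<alpha>0 h' \<and> lo \<alpha> < s \<and> s < hi \<alpha>" for \<alpha> s
    unfolding R_def by auto
  have "open R"
    unfolding R_def
    by (intro open_Int W continuous_open_preimage open_Times continuous_intros
        continuous_on_compose2[OF lohi(1)] continuous_on_compose2[OF lohi(2)]) auto
  have \<alpha>0: "\<alpha>0 \<in> ball \<alpha>0 h'" using h' by simp
  have "\<phi> (\<alpha>0, x0 - l *\<^sub>R a) < \<phi> (\<alpha>0, (x0 - l *\<^sub>R a) + l *\<^sub>R a)"
  proof (rule pos_along_segment)
    fix t :: real assume t: "0 \<le> t" "t \<le> 1"
    have eq: "x0 - l *\<^sub>R a + t *\<^sub>R l *\<^sub>R a = x0 + (t - 1) *\<^sub>R l *\<^sub>R a" by (simp add: algebra_simps)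
    have "x0 - l *\<^sub>R a + t *\<^sub>R l *\<^sub>R a \<in> ball x0 \<rho>"
      unfolding eq using t by (intro seg) auto
    from good[OF \<alpha>0 this] show "(\<alpha>0, x0 - l *\<^sub>R a + t *\<^sub>R l *\<^sub>R a) \<in> D \<and>
        0 < (l *\<^sub>R a) \<bullet> grad \<alpha>0 (x0 - l *\<^sub>R a + t *\<^sub>R l *\<^sub>R a)"
      using l by (simp add: inner_commute)
  qed
  moreover have "\<phi> (\<alpha>0, x0) < \<phi> (\<alpha>0, x0 + l *\<^sub>R a)"
  proof (rule pos_along_segment)
    fix t :: real assume t: "0 \<le> t" "t \<le> 1"
    then have "x0 + t *\<^sub>R l *\<^sub>R a \<in> ball x0 \<rho>" using seg[of t] by auto
    from good[OF \<alpha>0 this] show "(\<alpha>0, x0 + t *\<^sub>R l *\<^sub>R a) \<in> D \<and>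
        0 < (l *\<^sub>R a) \<bullet> grad \<alpha>0 (x0 + t *\<^sub>R l *\<^sub>R a)"
      using l by (simp add: inner_commute)
  qed
  ultimately have p0R: "(\<alpha>0, \<phi> (\<alpha>0, x0)) \<in> R"
    unfolding R_iff lo_def hi_def using W \<alpha>0 by simp
  obtain T where T: "T > 0" "\<And>p. p \<in> K \<Longrightarrow> norm p \<le> T"
    using compact_imp_bounded[OF K(1)] unfolding bounded_pos by blast
  show thesis
  proof
    show "open R" by fact
    show "(\<alpha>0, \<phi> (\<alpha>0, x0)) \<in> R" by fact
    fix \<epsilon> :: real assume "0 < \<epsilon>"
    \<comment> \<open>\<open>K\<close> lies over the interval \<open>[-T, T]\<close>, so slices of
      size \<open>d\<close> contribute at most \<epsilon>.\<close>
    define d where "d = \<epsilon> / (2 * T)"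
    have d: "0 < d" "2 * T * d = \<epsilon>" using \<open>0 < \<epsilon>\<close> T by (auto simp: d_def)
    obtain V where V: "open V" "closure V \<subseteq> ball x0 \<rho>"
      and cov: "\<And>h. continuous_on (ball x0 \<rho>) h \<Longrightarrow> increasing_along a b (ball x0 \<rho>) h \<Longrightarrow>
        h ` closed_segment q (q + (2 * l) *\<^sub>R a) \<subseteq> h ` V"
      and sm: "\<And>\<alpha>. \<alpha> \<in> {\<alpha>. \<bar>\<alpha> - \<alpha>0\<bar> \<ge> h1} \<Longrightarrow>
        small ((\<lambda>x. \<phi> (\<alpha>, x)) ` (closure V \<inter> slice K \<alpha>)) d"
      using venetian_blind[OF K open_ball q_seg _ d(1) \<rho>3(2), of "{\<alpha>. \<bar>\<alpha> - \<alpha>0\<bar> \<ge> h1}" b thesis]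
        kill \<rho>(4) l(1) by auto
    have "compact (closure V)"
      using V(2) by (metis bounded_ball bounded_subset closed_closure compact_eq_bounded_closed)
    have VU: "closure V \<subseteq> U"
      using V(2) near(3)[of \<alpha>0] h1 \<rho>(2) by auto
    have RD: "fst ` R \<times> closure V \<subseteq> D"
      using good(1) V(2) R_iff by auto
    have RV: "R \<subseteq> shadow \<phi> D V"
    proof
      fix p assume "p \<in> R"
      moreover obtain \<alpha> s where p: "p = (\<alpha>, s)" by (cases p)
      ultimately have \<alpha>: "\<alpha> \<in> ball \<alpha>0 h'" and s: "lo \<alpha> < s" "s < hi \<alpha>" by (auto simp: R_iff)
      have "q + (2 * l) *\<^sub>R a = x0 + l *\<^sub>R a" unfolding q_def mult_2 scaleR_add_left by simp
      then have "lo \<alpha> \<in> (\<lambda>x. \<phi> (\<alpha>, x)) ` closed_segment q (q + (2 * l) *\<^sub>R a)"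
        "hi \<alpha> \<in> (\<lambda>x. \<phi> (\<alpha>, x)) ` closed_segment q (q + (2 * l) *\<^sub>R a)"
        unfolding lo_def hi_def q_def by (metis ends_in_segment(1) imageI, metis ends_in_segment(2) imageI)
      moreover have "connected ((\<lambda>x. \<phi> (\<alpha>, x)) ` closed_segment q (q + (2 * l) *\<^sub>R a))"
        by (intro connected_continuous_image continuous_on_subset[OF cont[OF \<alpha>] q_seg]) simp
      ultimately have "s \<in> (\<lambda>x. \<phi> (\<alpha>, x)) ` closed_segment q (q + (2 * l) *\<^sub>R a)"
        using s by (meson connectedD_interval less_imp_le)
      then have "s \<in> (\<lambda>x. \<phi> (\<alpha>, x)) ` V"
        using cov[OF cont[OF \<alpha>] mono[OF \<alpha>]] by blast
      then obtain x where x: "x \<in> V" "s = \<phi> (\<alpha>, x)" by blast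
      then have "(\<alpha>, x) \<in> D" using V(2) closure_subset good(1)[OF \<alpha>] by blast
      then show "p \<in> shadow \<phi> D V" unfolding shadow_def p using x by blast
    qed
    \<comment> \<open>With the closure of \<open>V\<close> in place of \<open>V\<close> the image is
      compact, which makes \<open>N\<close> Borel.\<close>
    define N where "N = (\<lambda>p. (fst p, \<phi> p)) ` (K \<inter> UNIV \<times> closure V) - W"
    have "compact (K \<inter> UNIV \<times> closure V)"
      by (intro compact_Int_closed K closed_Times) auto
    then have "closed ((\<lambda>p. (fst p, \<phi> p)) ` (K \<inter> UNIV \<times> closure V))"
      using K(2) by (intro compact_imp_closed compact_continuous_image continuous_intros
          continuous_on_subset[OF cont_\<phi>]) auto
    then have NB: "N \<in> sets borel" unfolding N_def using W by (intro sets.Diff) auto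
    have "shadow \<phi> K V - W \<subseteq> N"
    proof
      fix p assume "p \<in> shadow \<phi> K V - W"
      then obtain \<alpha> x where p: "p = (\<alpha>, \<phi> (\<alpha>, x))" "p \<notin> W" and x: "(\<alpha>, x) \<in> K" "x \<in> V"
        unfolding shadow_def by blast
      then have "(\<alpha>, x) \<in> K \<inter> UNIV \<times> closure V"
        using closure_subset by blast
      then have "p \<in> (\<lambda>p. (fst p, \<phi> p)) ` (K \<inter> UNIV \<times> closure V)"
        unfolding p(1) by (rule rev_image_eqI) simp
      with p(2) show "p \<in> N" unfolding N_def by blast
    qed
    moreover have "emeasure lborel N \<le> ennreal (2 * T * d)"
    proof (rule emeasure_le_of_small_slices[OF NB])
      show "N \<subseteq> {- T..T} \<times> UNIV"
      proof
        fix p assume "p \<in> N"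
        then obtain \<alpha> x where "(\<alpha>, x) \<in> K" "fst p = \<alpha>" unfolding N_def by auto
        moreover have "\<bar>\<alpha>\<bar> \<le> norm (\<alpha>, x)" using norm_fst_le[of \<alpha> x] by simp
        ultimately have "\<bar>fst p\<bar> \<le> T" using T(2)[of "(\<alpha>, x)"] by simp
        then show "p \<in> {- T..T} \<times> UNIV" by (cases p) auto
      qed
      fix \<alpha>
      show "small (Pair \<alpha> -` N) d"
      proof (cases "\<bar>\<alpha> - \<alpha>0\<bar> \<ge> h1")
        case True
        have "Pair \<alpha> -` N \<subseteq> (\<lambda>x. \<phi> (\<alpha>, x)) ` (closure V \<inter> slice K \<alpha>)"
          unfolding N_def slice_def by auto
        with sm True show ?thesis by (auto intro: small_subset)
      next
        case False
        have "(\<alpha>, \<phi> (\<alpha>, x)) \<in> W" if "x \<in> closure V" for x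
        proof (rule near(2))
          show "x \<in> ball x0 \<rho>1" using that V(2) subset_ball[of \<rho> \<rho>1 x0] \<rho>(2) by auto
        qed (use False in simp)
        then have "Pair \<alpha> -` N = {}" unfolding N_def by auto
        then show ?thesis unfolding small_def by (intro bexI[of _ "{}"]) auto
      qed
    qed (use d T in auto)
    ultimately show "\<exists>V. open V \<and> compact (closure V) \<and> closure V \<subseteq> U \<and> fst ` R \<times> closure V \<subseteq> D \<and>
      R \<subseteq> shadow \<phi> D V \<and> (\<exists>N\<in>sets borel. shadow \<phi> K V - W \<subseteq> N \<and> emeasure lborel N \<le> ennreal \<epsilon>)"
      using V(1) \<open>compact (closure V)\<close> VU RD RV NB unfolding d(2)
      by (intro exI[of _ V] conjI bexI[of _ N]) auto
  qed
qed

section \<open>Iteration\<close>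

text \<open>One step of the iteration. Covering is required member by member and not just for the
  unions: a point of \<open>T\<close> must be followed through sets with nested closures. The
  compactness of the closures and their inclusion in \<open>D\<close> over the parameter of the
  point later give a common preimage in the limit.\<close>

definition refines ::
    "(real \<times> real) set \<Rightarrow> (real \<times> real \<times> real) set \<Rightarrow> real \<Rightarrow> (nat \<Rightarrow> (real \<times> real) set) \<Rightarrow>
      (nat \<Rightarrow> (real \<times> real) set) \<Rightarrow> bool" where
  "refines T K \<epsilon> c c' \<longleftrightarrow>
    (\<forall>m. open (c' m) \<and> compact (closure (c' m))) \<and>
    (\<forall>n p. p \<in> shadow \<phi> D (c n) \<longrightarrow> p \<in> T \<longrightarrow>
      (\<exists>m. p \<in> shadow \<phi> D (c' m) \<and> closure (c' m) \<subseteq> c n \<and> {fst p} \<times> closure (c' m) \<subseteq> D)) \<and>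
    (\<exists>N\<in>sets borel. shadow \<phi> K (\<Union>m. c' m) - T \<subseteq> N \<and> emeasure lborel N \<le> ennreal \<epsilon>)"

text \<open>The sets \<open>R\<close> of \<open>local_venetian_blind\<close> form an open cover of
  the part of the shadow of \<open>c n\<close> inside \<open>T\<close>. Lindelof reduces it to a
  countable one for each \<open>n\<close>; only then are the blinds chosen, the one with index
  \<open>m\<close> having excess at most \<open>\<epsilon> / 2 ^ (m + 1)\<close>.\<close>

lemma ex_refines:
  assumes c: "\<And>n. open (c n)" and T: "open T" and K: "compact K" "K \<subseteq> D" and "0 < \<epsilon>"
  shows "\<exists>c'. refines T K \<epsilon> c c'"
proof -
  define fits where "fits n R \<epsilon> V \<longleftrightarrow> open V \<and> compact (closure V) \<and> closure V \<subseteq> c n \<and>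
    fst ` R \<times> closure V \<subseteq> D \<and> R \<subseteq> shadow \<phi> D V \<and>
    (\<exists>N\<in>sets borel. shadow \<phi> K V - T \<subseteq> N \<and> emeasure lborel N \<le> ennreal \<epsilon>)" for n R \<epsilon> V
  define \<F> where "\<F> n = {R. open R \<and> (\<forall>\<epsilon>>0. \<exists>V. fits n R \<epsilon> V)}" for n
  have ex: "p \<in> \<Union>(\<F> n)" if p: "p \<in> shadow \<phi> D (c n)" "p \<in> T" for n p
  proof -
    obtain \<alpha> x where x: "p = (\<alpha>, \<phi> (\<alpha>, x))" "(\<alpha>, x) \<in> D" "x \<in> c n"
      using p unfolding shadow_def by blast
    from local_venetian_blind[OF x(2) c x(3) T p(2)[unfolded x(1)] K]
    obtain R where "open R" "(\<alpha>, \<phi> (\<alpha>, x)) \<in> R" "\<And>\<epsilon>. 0 < \<epsilon> \<Longrightarrow> \<exists>V. fits n R \<epsilon> V"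
      unfolding fits_def by metis
    then show ?thesis unfolding \<F>_def x(1) by blast
  qed
  have "\<exists>\<G>\<subseteq>\<F> n. countable \<G> \<and> \<Union>\<G> = \<Union>(\<F> n)" for n
  proof -
    have "\<And>S. S \<in> \<F> n \<Longrightarrow> open S" by (simp add: \<F>_def)
    then obtain \<G> where "\<G> \<subseteq> \<F> n" "countable \<G>" "\<Union>\<G> = \<Union>(\<F> n)"
      by (rule Lindelof)
    then show ?thesis by blast
  qed
  then obtain \<G> where \<G>: "\<And>n. \<G> n \<subseteq> \<F> n" "\<And>n. countable (\<G> n)" "\<And>n. \<Union>(\<G> n) = \<Union>(\<F> n)"
    by metis
  \<comment> \<open>The dummy pair, served by the empty blind, keeps \<open>Q\<close> nonempty, so
    that \<open>from_nat_into\<close> enumerates exactly \<open>Q\<close>.\<close>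
  define Q where "Q = insert (0, {}) (SIGMA n:UNIV. \<G> n)"
  have "{} \<in> \<F> 0"
    unfolding \<F>_def fits_def by (auto simp: shadow_def intro!: exI[of _ "{}"] bexI[of _ "{}"])
  then have Q\<F>: "R \<in> \<F> n" if "(n, R) \<in> Q" for n R
    using that \<G>(1) unfolding Q_def by blast
  have "countable Q" unfolding Q_def using \<G>(2) by auto
  then have q: "range (from_nat_into Q) = Q" by (intro range_from_nat_into) (simp add: Q_def)
  have "\<exists>V. fits (fst (from_nat_into Q m)) (snd (from_nat_into Q m)) (\<epsilon> * (1 / 2) ^ Suc m) V" for m
  proof -
    have "from_nat_into Q m \<in> Q" using q by blast
    then have "snd (from_nat_into Q m) \<in> \<F> (fst (from_nat_into Q m))"
      using Q\<F> by (metis prod.collapse)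
    then show ?thesis using \<open>0 < \<epsilon>\<close> unfolding \<F>_def by simp
  qed
  then obtain c' where c': "\<And>m. fits (fst (from_nat_into Q m)) (snd (from_nat_into Q m)) (\<epsilon> * (1 / 2) ^ Suc m) (c' m)"
    by metis
  then have "\<exists>N\<in>sets borel. shadow \<phi> K (c' m) - T \<subseteq> N \<and> emeasure lborel N \<le> ennreal (\<epsilon> * (1 / 2) ^ Suc m)" for m
    unfolding fits_def by blast
  then obtain N where N: "\<And>m. N m \<in> sets borel" "\<And>m. shadow \<phi> K (c' m) - T \<subseteq> N m"
    "\<And>m. emeasure lborel (N m) \<le> ennreal (\<epsilon> * (1 / 2) ^ Suc m)"
    by metis
  have "\<exists>m. p \<in> shadow \<phi> D (c' m) \<and> closure (c' m) \<subseteq> c n \<and> {fst p} \<times> closure (c' m) \<subseteq> D"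
    if p: "p \<in> shadow \<phi> D (c n)" "p \<in> T" for n p
  proof -
    obtain R where R: "R \<in> \<G> n" "p \<in> R" using ex[OF p] \<G>(3) by blast
    then have "(n, R) \<in> range (from_nat_into Q)" unfolding q by (simp add: Q_def)
    then obtain m where "from_nat_into Q m = (n, R)" by (metis imageE)
    then have "fits n R (\<epsilon> * (1 / 2) ^ Suc m) (c' m)" using c'[of m] by simp
    then show ?thesis
      using R(2) unfolding fits_def by (intro exI[of _ m]) blast
  qed
  moreover have "open (c' m) \<and> compact (closure (c' m))" for m
    using c'[of m] unfolding fits_def by blast
  moreover have "emeasure lborel (\<Union>m. N m) \<le> ennreal \<epsilon>"
  proof -
    have "emeasure lborel (\<Union>m. N m) \<le> (\<Sum>m. emeasure lborel (N m))"
      using N(1) by (intro emeasure_subadditive_countably) auto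
    also have "\<dots> \<le> (\<Sum>m. ennreal (\<epsilon> * (1 / 2) ^ Suc m))"
      using N(3) by (intro suminf_le) auto
    also have "\<dots> = ennreal \<epsilon>"
      using sums_mult[OF power_half_series, of \<epsilon>] \<open>0 < \<epsilon>\<close>
      by (intro suminf_ennreal_eq) auto
    finally show ?thesis .
  qed
  moreover have "(\<Union>m. N m) \<in> sets borel"
    using N(1) by blast
  moreover have "shadow \<phi> K (\<Union>m. c' m) - T \<subseteq> (\<Union>m. N m)"
    unfolding shadow_UN using N(2) by blast
  ultimately show ?thesis
    unfolding refines_def by metis
qed

text \<open>Stage \<open>n\<close> refines towards an open \<open>T n\<close> containing
  \<open>A\<close> with excess at most \<open>2 ^ -n\<close>, and controls the shadow of
  \<open>K n\<close> up to another \<open>2 ^ -n\<close>. Points of \<open>A\<close> lie in every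
  \<open>T n\<close>, so they survive all stages and, by compactness, the intersection. A point of
  the shadow outside \<open>A\<close> lies in the exceptional sets of all sufficiently late
  stages.\<close>

lemma exists_borel_set_with_prescribed_shadow:
  fixes A :: "(real \<times> real) set"
  assumes A: "A \<in> sets lebesgue" "A \<subseteq> shadow \<phi> D UNIV"
  obtains E where "E \<in> sets borel" "A \<subseteq> shadow \<phi> D E" "shadow \<phi> D E - A \<in> null_sets lebesgue"
proof -
  obtain K where K: "\<And>n. compact (K n)" "\<And>n. K n \<subseteq> D" "\<And>n. K n \<subseteq> interior (K (Suc n))" "\<Union>(range K) = D"
    using open_Union_compact_subsets[OF open_D] by metis
  have "mono K"
    using K(3) interior_subset by (intro incseq_SucI) blast
  have "\<exists>T. open T \<and> A \<subseteq> T \<and> T - A \<in> sets lebesgue \<and> emeasure lebesgue (T - A) \<le> ennreal ((1 / 2) ^ n)" for n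
    using sets_lebesgue_outer_open[OF A(1), of "(1 / 2) ^ n"]
    by (metis fmeasurableD less_imp_le half_gt_zero zero_less_one zero_less_power)
  then obtain T where T: "\<And>n. open (T n)" "\<And>n. A \<subseteq> T n" "\<And>n. T n - A \<in> sets lebesgue"
    "\<And>n. emeasure lebesgue (T n - A) \<le> ennreal ((1 / 2) ^ n)"
    by metis
  have half_pos: "(0::real) < (1 / 2) ^ n" for n by simp
  \<comment> \<open>Stage \<open>0\<close> is the whole plane, whose shadow contains
    \<open>A\<close> by assumption.\<close>
  have "\<exists>c. \<forall>n. ((\<forall>i. open (c n i)) \<and> (n = 0 \<longrightarrow> c n = (\<lambda>_. UNIV))) \<and>
      refines (T n) (K n) ((1 / 2) ^ n) (c n) (c (Suc n))"
  proof (rule dependent_nat_choice)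
    show "\<exists>c. (\<forall>i. open (c i)) \<and> (0 = (0::nat) \<longrightarrow> c = (\<lambda>_::nat. UNIV :: (real \<times> real) set))"
      by (intro exI[of _ "\<lambda>_. UNIV"]) simp
  next
    fix c :: "nat \<Rightarrow> (real \<times> real) set" and n :: nat
    assume "(\<forall>i. open (c i)) \<and> (n = 0 \<longrightarrow> c = (\<lambda>_. UNIV))"
    then have "open (c i)" for i by blast
    from ex_refines[where c = c, OF this T(1)[of n] K(1,2)[of n] half_pos[of n]]
    obtain c' where "refines (T n) (K n) ((1 / 2) ^ n) c c'" by blast
    moreover from this have "open (c' i)" for i unfolding refines_def by blast
    ultimately show "\<exists>c'. ((\<forall>i. open (c' i)) \<and> (Suc n = 0 \<longrightarrow> c' = (\<lambda>_. UNIV))) \<and>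
        refines (T n) (K n) ((1 / 2) ^ n) c c'"
      by (intro exI[of _ c']) simp
  qed
  then obtain c where c: "\<And>n i. open (c n i)" "c 0 = (\<lambda>_. UNIV)"
    and ref: "\<And>n. refines (T n) (K n) ((1 / 2) ^ n) (c n) (c (Suc n))"
    by metis
  have "\<exists>N\<in>sets borel. shadow \<phi> (K n) (\<Union>m. c (Suc n) m) - T n \<subseteq> N \<and> emeasure lborel N \<le> ennreal ((1 / 2) ^ n)" for n
    using ref[of n] unfolding refines_def by blast
  then obtain N where N: "\<And>n. N n \<in> sets borel" "\<And>n. shadow \<phi> (K n) (\<Union>m. c (Suc n) m) - T n \<subseteq> N n"
    "\<And>n. emeasure lborel (N n) \<le> ennreal ((1 / 2) ^ n)"
    by metis
  define E where "E = (\<Inter>n. \<Union>i. c n i)"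
  show thesis
  proof
    show "E \<in> sets borel"
      unfolding E_def using c(1) by (intro sets.countable_INT) auto
  next
    show "A \<subseteq> shadow \<phi> D E"
    proof
      fix p assume p: "p \<in> A"
      obtain \<alpha> t where pt: "p = (\<alpha>, t)" by (cases p)
      have "\<exists>i. \<forall>n. p \<in> shadow \<phi> D (c n (i n)) \<and>
          (closure (c (Suc n) (i (Suc n))) \<subseteq> c n (i n) \<and> {fst p} \<times> closure (c (Suc n) (i (Suc n))) \<subseteq> D)"
      proof (rule dependent_nat_choice)
        show "\<exists>i. p \<in> shadow \<phi> D (c 0 i)" using p A(2) by (auto simp: c(2))
      next
        fix i n assume "p \<in> shadow \<phi> D (c n i)"
        moreover have "p \<in> T n" using p T(2) by blast
        ultimately show "\<exists>m. p \<in> shadow \<phi> D (c (Suc n) m) \<and>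
            closure (c (Suc n) m) \<subseteq> c n i \<and> {fst p} \<times> closure (c (Suc n) m) \<subseteq> D"
          using ref[of n] unfolding refines_def by blast
      qed
      then obtain i where "\<forall>n. p \<in> shadow \<phi> D (c n (i n)) \<and>
          (closure (c (Suc n) (i (Suc n))) \<subseteq> c n (i n) \<and> {fst p} \<times> closure (c (Suc n) (i (Suc n))) \<subseteq> D)"
        by blast
      then have i: "\<And>n. p \<in> shadow \<phi> D (c n (i n))"
        "\<And>n. closure (c (Suc n) (i (Suc n))) \<subseteq> c n (i n)"
        "\<And>n. {\<alpha>} \<times> closure (c (Suc n) (i (Suc n))) \<subseteq> D"
        by (simp_all add: pt)
      \<comment> \<open>The preimages of \<open>t\<close> in the closures are nested nonempty
        compact sets, so they have a common point. The index starts at \<open>Suc 0\<close> because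
        only refined stages have compact closures with \<phi> defined on them over \<alpha>.\<close>
      define X where "X n = closure (c (Suc n) (i (Suc n))) \<inter> (\<lambda>x. \<phi> (\<alpha>, x)) -` {t}" for n
      have "\<Inter>(range X) \<noteq> {}"
      proof (rule compact_nest)
        fix n
        have "continuous_on (closure (c (Suc n) (i (Suc n)))) (\<lambda>x. \<phi> (\<alpha>, x))"
          using i(3)[of n] by (intro continuous_on_compose2[OF cont_\<phi>] continuous_intros) auto
        then have "closed (X n)"
          unfolding X_def by (intro continuous_closed_preimage) auto
        moreover have "compact (closure (c (Suc n) (i (Suc n))))"
          using ref[of n] unfolding refines_def by blast
        ultimately have "compact (closure (c (Suc n) (i (Suc n))) \<inter> X n)"
          by (intro compact_Int_closed)
        then show "compact (X n)"
          by (rule back_subst[of compact]) (auto simp: X_def)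
        show "X n \<noteq> {}"
          using i(1)[of "Suc n"] closure_subset unfolding shadow_def X_def pt by fastforce
      next
        have "decseq X"
        proof (rule decseq_SucI)
          fix n
          have "closure (c (Suc (Suc n)) (i (Suc (Suc n)))) \<subseteq> closure (c (Suc n) (i (Suc n)))"
            using i(2)[of "Suc n"] closure_subset by blast
          then show "X (Suc n) \<subseteq> X n" unfolding X_def by blast
        qed
        then show "X n \<subseteq> X m" if "m \<le> n" for m n
          using that by (rule decseqD)
      qed
      then obtain x where x: "\<And>n. x \<in> X n" by blast
      have "x \<in> c n (i n)" for n
        using x[of n] i(2)[of n] unfolding X_def by blast
      then have "x \<in> E" unfolding E_def by blast
      moreover have "(\<alpha>, x) \<in> D" "\<phi> (\<alpha>, x) = t"
        using x[of 0] i(3)[of 0] unfolding X_def by auto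
      ultimately show "p \<in> shadow \<phi> D E" unfolding shadow_def pt by blast
    qed
  next
    \<comment> \<open>A curve point coming from \<open>K m\<close> is controlled from stage
      \<open>m\<close> onwards. \<open>Z m\<close> has measure at most \<open>2 * 2 ^ -n\<close> for
      every \<open>n \<ge> m\<close>, hence zero.\<close>
    define Z where "Z m = (\<Inter>n\<in>{m..}. (T n - A) \<union> N n)" for m
    have NL: "N n \<in> sets lebesgue" "emeasure lebesgue (N n) \<le> ennreal ((1 / 2) ^ n)" for n
      using N(1,3)[of n] by auto
    have ZL: "Z m \<in> sets lebesgue" for m
      unfolding Z_def using T(3) NL(1) by (intro sets.countable_INT') auto
    have "emeasure lebesgue (Z m) = 0" for m
    proof -
      have le: "emeasure lebesgue (Z m) \<le> 0 + ennreal e" if "0 < e" for e :: real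
      proof -
        obtain k where k: "(1 / 2) ^ k < e / 2"
          using real_arch_pow_inv[of "e / 2" "1 / 2"] \<open>0 < e\<close> by auto
        define n where "n = max m k"
        have "(1 / 2 :: real) ^ n \<le> (1 / 2) ^ k"
          by (intro power_decreasing) (auto simp: n_def)
        with k have n: "(1 / 2 :: real) ^ n + (1 / 2) ^ n \<le> e" by linarith
        have "emeasure lebesgue (Z m) \<le> emeasure lebesgue ((T n - A) \<union> N n)"
          unfolding Z_def using T(3) NL(1) by (intro emeasure_mono) (auto simp: n_def)
        also have "\<dots> \<le> emeasure lebesgue (T n - A) + emeasure lebesgue (N n)"
          using T(3) NL(1) by (intro emeasure_subadditive) auto
        also have "\<dots> \<le> ennreal ((1 / 2) ^ n) + ennreal ((1 / 2) ^ n)"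
          by (intro add_mono T(4) NL(2))
        also have "\<dots> = ennreal ((1 / 2) ^ n + (1 / 2) ^ n)"
          by (rule ennreal_plus[symmetric]) auto
        also have "\<dots> \<le> ennreal e" using n by (rule ennreal_leI)
        finally show ?thesis by simp
      qed
      have "emeasure lebesgue (Z m) \<le> 0"
        by (rule ennreal_le_epsilon) (rule le)
      then show ?thesis by simp
    qed
    then have "(\<Union>m. Z m) \<in> null_sets lebesgue"
      using ZL by (intro null_sets_UN) (auto simp: null_sets_def)
    moreover have "shadow \<phi> D E - A \<subseteq> (\<Union>m. Z m)"
    proof
      fix p assume p: "p \<in> shadow \<phi> D E - A"
      then obtain \<alpha> x where x: "p = (\<alpha>, \<phi> (\<alpha>, x))" "(\<alpha>, x) \<in> D" "x \<in> E"
        unfolding shadow_def by blast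
      then obtain m where "(\<alpha>, x) \<in> K m" using K(4) by blast
      then have m: "p \<in> shadow \<phi> (K m) E" unfolding shadow_def x(1) using x(3) by blast
      have "p \<in> (T n - A) \<union> N n" if "n \<ge> m" for n
      proof (cases "p \<in> T n")
        case False
        have "E \<subseteq> (\<Union>i. c (Suc n) i)" unfolding E_def by blast
        then have "shadow \<phi> (K m) E \<subseteq> shadow \<phi> (K n) (\<Union>i. c (Suc n) i)"
          by (intro shadow_mono monoD[OF \<open>mono K\<close> that])
        then have "p \<in> shadow \<phi> (K n) (\<Union>i. c (Suc n) i)"
          using m by (rule subsetD)
        then show ?thesis using N(2)[of n] False by blast
      qed (use p in blast)
      then show "p \<in> (\<Union>m. Z m)" unfolding Z_def by blast
    qed
    ultimately show "shadow \<phi> D E - A \<in> null_sets lebesgue"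
      using completion.complete2 by blast
  qed
qed

end

section \<open>Passage to slices\<close>

text \<open>Fubini is applied to a Borel null set containing \<open>Z\<close>, since it concerns the
  product of the uncompleted measures.\<close>

lemma AE_slice_null:
  fixes Z :: "(real \<times> real) set"
  assumes "Z \<in> null_sets lebesgue"
  shows "AE \<alpha> in lebesgue. Pair \<alpha> -` Z \<in> null_sets lebesgue"
proof -
  obtain Z' where Z': "Z' \<in> null_sets lborel" "Z \<subseteq> Z'"
    using assms unfolding null_sets_completion_iff2 by blast
  have "AE p in lborel \<Otimes>\<^sub>M lborel. p \<notin> Z'"
    using AE_not_in[OF Z'(1)] by (simp only: lborel_prod)
  then have "AE \<alpha> in lborel. AE t in lborel. (\<alpha>, t) \<notin> Z'"
    by (rule lborel_pair.AE_pair)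
  then have "AE \<alpha> in lborel. Pair \<alpha> -` Z \<in> null_sets lebesgue"
  proof (rule AE_mp, intro AE_I2 impI)
    fix \<alpha> assume "AE t in lborel. (\<alpha>, t) \<notin> Z'"
    then obtain N where "N \<in> null_sets lborel" "{t \<in> space lborel. \<not> (\<alpha>, t) \<notin> Z'} \<subseteq> N"
      unfolding eventually_ae_filter by blast
    with Z'(2) show "Pair \<alpha> -` Z \<in> null_sets lebesgue"
      unfolding null_sets_completion_iff2 by (intro bexI[of _ N]) auto
  qed
  then show ?thesis by (rule AE_completion)
qed

theorem theorem4p1:
  fixes D :: "(real \<times> real \<times> real) set"
    and \<phi> :: "real \<times> real \<times> real \<Rightarrow> real"
    and F :: "real \<Rightarrow> real set"
  assumes "open D"
    and "admissible D \<phi>"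
    and "\<And>\<alpha>. F \<alpha> \<subseteq> curry \<phi> \<alpha> ` slice D \<alpha>"
    and "(\<Union>\<alpha>. {\<alpha>} \<times> F \<alpha>) \<in> sets (lebesgue :: (real \<times> real) measure)"
  shows "\<exists>E :: (real \<times> real) set. E \<in> sets borel \<and>
    (\<forall>\<alpha>. F \<alpha> \<subseteq> curry \<phi> \<alpha> ` (E \<inter> slice D \<alpha>)) \<and>
    (AE \<alpha> in lebesgue. curry \<phi> \<alpha> ` (E \<inter> slice D \<alpha>) - F \<alpha> \<in> null_sets lebesgue)"
proof -
  interpret admissible_family D \<phi>
    using assms(1,2) unfolding admissible_def by unfold_locales auto
  define A where "A = (\<Union>\<alpha>. {\<alpha>} \<times> F \<alpha>)"
  have "A \<subseteq> shadow \<phi> D UNIV"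
  proof
    fix p assume "p \<in> A"
    then obtain \<alpha> t where p: "p = (\<alpha>, t)" and "t \<in> F \<alpha>" unfolding A_def by blast
    then have "t \<in> curry \<phi> \<alpha> ` slice D \<alpha>" by (intro subsetD[OF assms(3)])
    then show "p \<in> shadow \<phi> D UNIV" unfolding shadow_def slice_def p by auto
  qed
  then obtain E where E: "E \<in> sets borel" "A \<subseteq> shadow \<phi> D E" "shadow \<phi> D E - A \<in> null_sets lebesgue"
    using exists_borel_set_with_prescribed_shadow[OF assms(4)[folded A_def]] by blast
  \<comment> \<open>Both sets in the conclusion are vertical slices, one of the shadow of
    \<open>E\<close> and one of \<open>A\<close>, so the last claim concerns the slices of a single
    null set.\<close>
  have img: "curry \<phi> \<alpha> ` (E \<inter> slice D \<alpha>) = Pair \<alpha> -` shadow \<phi> D E" for \<alpha>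
    unfolding shadow_def slice_def by auto
  have F: "F \<alpha> = Pair \<alpha> -` A" for \<alpha>
    unfolding A_def by auto
  show ?thesis
  proof (intro exI[of _ E] conjI allI)
    show "E \<in> sets borel" by fact
    show "F \<alpha> \<subseteq> curry \<phi> \<alpha> ` (E \<inter> slice D \<alpha>)" for \<alpha>
      unfolding img F using E(2) by blast
    show "AE \<alpha> in lebesgue. curry \<phi> \<alpha> ` (E \<inter> slice D \<alpha>) - F \<alpha> \<in> null_sets lebesgue"
      unfolding img F vimage_Diff[symmetric] by (rule AE_slice_null[OF E(3)])
  qed
qed

end
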